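(* Let $\mathbb A$ be one of the algebras $\mathscr O_b,\mathscr W,\mathscr A,\mathscr H^\infty$, and let $\mathscr D_{\mathbb A}\subset\mathscr D$ be the subalgebra of Dirichlet series converging to functions in $\mathbb A$. Then $\mathscr D_{\mathbb A}$ is invariant with respect to the action $S$ of $S_{\mathbb N}$, i.e., $S_\sigma(\mathscr D_{\mathbb A})\subset\mathscr D_{\mathbb A}$ for all $\sigma\in S_{\mathbb N}$.
   Context: $\mathscr D$ is the unital algebra of formal Dirichlet series $D=\sum_{n\ge1}a_nn^{-s}$, $a_n\in\mathbb C$, with coefficientwise addition and product $\big(\sum a_nn^{-s}\big)\big(\sum b_nn^{-s}\big)=\sum_n\big(\sum_{d\mid n}a_db_{n/d}\big)n^{-s}$. Let $\mathbb C_+=\{s\in\mathbb C:\mathrm{Re}\,s>0\}$; proper half-planes of $\mathbb C_+$ are the sets $\{\mathrm{Re}\,s>\varepsilon\}$, $\varepsilon>0$. $\mathscr O_u$ is the algebra of holomorphic functions on $\mathbb C_+$ that are limits of Dirichlet series converging uniformly on proper half-planes of $\mathbb C_+$ (the Dirichlet series of $f\in\mathscr O_u$ is unique). $\Omega(n)$ is the number of prime factors of $n$ counted with multiplicity. For $f\in\mathscr O_u$ with Dirichlet series $\sum a_nn^{-s}$ and $r\in(0,1)$, $f_r\in\mathscr O_u$ denotes the limit function of $\sum r^{\Omega(n)}a_nn^{-s}$ (which also converges uniformly on proper half-planes). - $\mathscr O_b$: all $f\in\mathscr O_u$ with $f_r$ bounded on $\mathbb C_+$ for every $r\in(0,1)$.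 - $\mathscr H^\infty$: bounded functions in $\mathscr O_u$, with the supremum norm. - $\mathscr W$: limit functions of Dirichlet series with $\sum|a_n|<\infty$. - $\mathscr A$: the closure of $\mathscr W$ in $\mathscr H^\infty$. $S_{\mathbb N}$ is the group of all permutations of $\mathbb N=\{1,2,\dots\}$; $p_1<p_2<\cdots$ are the primes and $\nu_{p}(n)$ is the exponent of $p$ in $n$. For $\sigma\in S_{\mathbb N}$, $\hat\sigma:\mathbb N\to\mathbb N$ is the completely multiplicative permutation $\hat\sigma(n)=\prod_i p_{\sigma(i)}^{\nu_{p_i}(n)}$, and $S_\sigma(D)=\sum_{n\ge1}a_{\hat\sigma^{-1}(n)}n^{-s}$ for $D=\sum_{n\ge1}a_nn^{-s}\in\mathscr D$. *)

theory Defs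
  imports
    "HOL-Complex_Analysis.Complex_Analysis"
    "HOL-Computational_Algebra.Computational_Algebra"
    "HOL-Combinatorics.Permutations"
begin

definition right_half_plane :: "complex set" where
  "right_half_plane = {s. 0 < Re s}"

text \<open>
  A formal Dirichlet series is given by its coefficients \<open>a 1, a 2, \<dots>\<close>; the unused value at
  index 0 is normalised to 0.
\<close>

definition formal_dirichlet_series :: "(nat \<Rightarrow> complex) set" where
  "formal_dirichlet_series = {a. a 0 = 0}"

definition dirichlet_partial_sum :: "(nat \<Rightarrow> complex) \<Rightarrow> nat \<Rightarrow> complex \<Rightarrow> complex" where
  "dirichlet_partial_sum a N s = (\<Sum>n=1..N. a n * of_nat n powr (- s))"

definition dirichlet_converges_to :: "(nat \<Rightarrow> complex) \<Rightarrow> (complex \<Rightarrow> complex) \<Rightarrow> bool" where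
  "dirichlet_converges_to a f \<longleftrightarrow>
     (\<forall>\<epsilon>>0. uniform_limit {s. \<epsilon> < Re s} (dirichlet_partial_sum a) f sequentially)"

definition dirichlet_limit :: "(nat \<Rightarrow> complex) \<Rightarrow> complex \<Rightarrow> complex" where
  "dirichlet_limit a s = lim (\<lambda>N. dirichlet_partial_sum a N s)"

text \<open>
  Functions on the right half-plane are represented by total functions on the complex plane. All
  the function spaces below only constrain the values on the right half-plane, so their elements
  are to be read modulo equality there.
\<close>

definition O_u :: "(complex \<Rightarrow> complex) set" where
  "O_u = {f. f holomorphic_on right_half_plane \<and>
             (\<exists>a\<in>formal_dirichlet_series. dirichlet_converges_to a f)}"

text \<open>The coefficients \<open>r\<^bsup>\<Omega>(n)\<^esup> a\<^sub>n\<close>, where \<open>\<Omega>\<close> counts prime factors with multiplicity.\<close>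

definition dirichlet_dilate :: "real \<Rightarrow> (nat \<Rightarrow> complex) \<Rightarrow> nat \<Rightarrow> complex" where
  "dirichlet_dilate r a n = of_real r ^ size (prime_factorization n) * a n"

text \<open>
  Since the Dirichlet series \<open>a\<close> of \<open>f\<close> is unique, \<open>dirichlet_limit (dirichlet_dilate r a)\<close> below
  is the function \<open>f\<^sub>r\<close>.
\<close>

definition O_b :: "(complex \<Rightarrow> complex) set" where
  "O_b = {f \<in> O_u. \<exists>a\<in>formal_dirichlet_series. dirichlet_converges_to a f \<and>
            (\<forall>r\<in>{0<..<1}. bounded (dirichlet_limit (dirichlet_dilate r a) ` right_half_plane))}"

definition H_infinity :: "(complex \<Rightarrow> complex) set" where
  "H_infinity = {f \<in> O_u. bounded (f ` right_half_plane)}"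

definition H_infinity_norm :: "(complex \<Rightarrow> complex) \<Rightarrow> real" where
  "H_infinity_norm f = (SUP s\<in>right_half_plane. norm (f s))"

definition dirichlet_W :: "(complex \<Rightarrow> complex) set" where
  "dirichlet_W = {f \<in> O_u. \<exists>a\<in>formal_dirichlet_series. dirichlet_converges_to a f \<and>
                    summable (\<lambda>n. norm (a n))}"

text \<open>The closure of \<open>dirichlet_W\<close> in \<open>H_infinity\<close> for the supremum norm.\<close>

definition dirichlet_A :: "(complex \<Rightarrow> complex) set" where
  "dirichlet_A = {f \<in> H_infinity. \<forall>\<epsilon>>0. \<exists>g\<in>dirichlet_W. H_infinity_norm (\<lambda>s. f s - g s) < \<epsilon>}"

definition dirichlet_series_of :: "(complex \<Rightarrow> complex) set \<Rightarrow> (nat \<Rightarrow> complex) set" where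
  "dirichlet_series_of \<A> = {a \<in> formal_dirichlet_series. \<exists>f\<in>\<A>. dirichlet_converges_to a f}"

text \<open>The primes are numbered from 1, whereas \<open>enumerate\<close> starts at 0.\<close>

definition nth_prime :: "nat \<Rightarrow> nat" where
  "nth_prime i = enumerate {p. prime p} (i - 1)"

text \<open>The (finitely many, for \<open>n \<ge> 1\<close>) indices with nontrivial exponent suffice in the product.\<close>

definition prime_permutation :: "(nat \<Rightarrow> nat) \<Rightarrow> nat \<Rightarrow> nat" where
  "prime_permutation \<sigma> n =
     (\<Prod>i | 1 \<le> i \<and> nth_prime i dvd n. nth_prime (\<sigma> i) ^ multiplicity (nth_prime i) n)"

definition dirichlet_action :: "(nat \<Rightarrow> nat) \<Rightarrow> (nat \<Rightarrow> complex) \<Rightarrow> nat \<Rightarrow> complex" where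
  "dirichlet_action \<sigma> a n =
     (if n = 0 then 0 else a (inv_into {1..} (prime_permutation \<sigma>) n))"

end

theory Submission
  imports Defs
begin

text \<open>
The value of a Dirichlet series at \<open>s\<close> is \<open>\<Sum> a n * \<chi> n\<close>, where \<open>\<chi>\<close> is the completely
multiplicative function with \<open>\<chi> p = p powr (-s)\<close> at the primes. Following Bohr, one lets \<open>\<chi> p = z p\<close>
be an independent complex variable for every prime, so that the series becomes a power series in
infinitely many variables. A permutation of the primes is then a mere renaming of these variables.
It does not respect the line \<open>z p = p powr (-s)\<close>, however: half-planes
\<open>Re s > \<epsilon>\<close> are not preserved, since \<open>p powr (-\<epsilon>)\<close> and its permuted counterpart are not
comparable, and a rearranged uniformly convergent series has no obvious reason to converge.
The proof therefore describes each of the four algebras by conditions on the coefficients in which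
all primes play the same role.

The basic condition is \<open>bohr_bounded a M\<close>: the power series is bounded by \<open>M\<close> at all points of the open
polydisc with finitely many nonzero coordinates. It holds if and only if the Dirichlet series
converges uniformly on proper half-planes to a function that is bounded by \<open>M\<close>.

\<^item> From the limit function to the polydisc (\<open>bohr_bounded_of_limit\<close>): by Kronecker's theorem, the
  points with coordinates \<open>p powr (\<i> * t)\<close> are dense in a finite-dimensional torus, so a Dirichlet
  polynomial on a vertical line is as large as on the torus, and the maximum modulus principle in
  one variable at a time extends the bound to the polydisc.

\<^item> From the polydisc to convergence (\<open>dirichlet_partial_sum_bound\<close>): substituting
  \<open>z p * u ^ k p\<close> for \<open>z p\<close>, with \<open>k p\<close> the integer part of \<open>Q * ln p\<close>, gives a
  bounded power series in the single variable \<open>u\<close>. If \<open>Q\<close> is large compared with \<open>N\<close>, the terms with \<open>n \<le> N\<close>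
  are exactly those whose degree does not exceed some \<open>K\<close>. By Landau's argument, truncation at degree
  \<open>K\<close> costs a factor \<open>1 + ln (K + 1)\<close>, so the \<open>N\<close>-th partial sum is
  \<open>O(M * ln N)\<close> on the whole right half-plane. Summation by parts then yields uniform convergence with
  a rate that depends on \<open>M\<close> only (\<open>dirichlet_tail_bound\<close>). The rate also applies to the series
  restricted to \<open>N\<close>-smooth indices, whose values are values of the power series on the polydisc, and this
  gives the bound \<open>M\<close> for the limit function (\<open>bohr_bounded_imp_limit_le\<close>).

The case \<open>M = 0\<close> contains the uniqueness of the coefficients. The algebras \<open>\<H>\<^sup>\<infinity>\<close>,
\<open>\<O>\<^sub>b\<close>, \<open>\<W>\<close> and \<open>\<A>\<close> now correspond, respectively, to
Bohr boundedness of \<open>a\<close>, to Bohr boundedness of all dilates of \<open>a\<close>, to absolute summability, and to the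
existence of absolutely summable \<open>c\<close> with \<open>bohr_bounded (a - c) \<epsilon>\<close> for every \<open>\<epsilon> > 0\<close>.
Each of these conditions is invariant under permutations of the primes.
\<close>

section \<open>Completely multiplicative extensions\<close>

text \<open>
The completely multiplicative function with prescribed values at the primes. Complex values give
the monomials of Bohr's power series, real values their moduli, and prime values the
relabelling of prime factors that a permutation induces.
\<close>

definition mult_ext :: "(nat \<Rightarrow> 'a::comm_semiring_1) \<Rightarrow> nat \<Rightarrow> 'a" where
  "mult_ext z n = (\<Prod>p\<in>#prime_factorization n. z p)"

lemma mult_ext_1 [simp]: "mult_ext z (Suc 0) = 1"
  by (simp add: mult_ext_def)

lemma mult_ext_mult:
  "m > 0 \<Longrightarrow> n > 0 \<Longrightarrow> mult_ext z (m * n) = mult_ext z m * mult_ext z n"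
  by (simp add: mult_ext_def prime_factorization_mult)

lemma mult_ext_distrib: "mult_ext (\<lambda>p. z p * w p) n = mult_ext z n * mult_ext w n"
  by (simp add: mult_ext_def prod_mset.distrib)

lemma mult_ext_cong:
  "(\<And>p. p \<in> prime_factors n \<Longrightarrow> z p = w p) \<Longrightarrow> mult_ext z n = mult_ext w n"
  unfolding mult_ext_def by (metis (mono_tags, lifting) image_mset_cong)

lemma mult_ext_zero:
  fixes z :: "nat \<Rightarrow> 'a::semidom"
  shows "p \<in> prime_factors n \<Longrightarrow> z p = 0 \<Longrightarrow> mult_ext z n = 0"
  unfolding mult_ext_def by (auto intro: image_eqI[of _ _ p])

lemma norm_mult_ext:
  fixes z :: "nat \<Rightarrow> 'a::{comm_semiring_1, real_normed_div_algebra}"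
  shows "norm (mult_ext z n) = mult_ext (\<lambda>p. norm (z p)) n"
proof -
  have "norm (\<Prod>p\<in>#A. z p) = (\<Prod>p\<in>#A. norm (z p))" for A
    by (induction A) (auto simp: norm_mult)
  then show ?thesis by (simp add: mult_ext_def)
qed

lemma mult_ext_nonneg:
  fixes x :: "nat \<Rightarrow> real"
  assumes "\<And>p. prime p \<Longrightarrow> 0 \<le> x p"
  shows "0 \<le> mult_ext x n"
proof -
  have "0 \<le> (\<Prod>p\<in>#A. x p)" if "\<forall>p\<in>#A. prime p" for A
    using that assms by (induction A) auto
  from this[of "prime_factorization n"] show ?thesis by (auto simp: mult_ext_def)
qed

lemma mult_ext_le_1:
  fixes x :: "nat \<Rightarrow> real"
  assumes "\<And>p. prime p \<Longrightarrow> 0 \<le> x p \<and> x p \<le> 1"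
  shows "mult_ext x n \<le> 1"
proof -
  have "0 \<le> (\<Prod>p\<in>#A. x p) \<and> (\<Prod>p\<in>#A. x p) \<le> 1" if "\<forall>p\<in>#A. prime p" for A
    using that assms by (induction A) (auto intro: mult_le_one)
  from this[of "prime_factorization n"] show ?thesis by (auto simp: mult_ext_def)
qed

lemma norm_mult_ext_le_1:
  fixes z :: "nat \<Rightarrow> complex"
  assumes "\<And>p. prime p \<Longrightarrow> norm (z p) \<le> 1"
  shows "norm (mult_ext z n) \<le> 1"
  unfolding norm_mult_ext using assms by (intro mult_ext_le_1) auto

lemma mult_ext_const: "mult_ext (\<lambda>_. c) n = c ^ size (prime_factorization n)"
  by (simp add: mult_ext_def)

lemma norm_nat_powr: "norm (complex_of_nat n powr s) = real n powr Re s"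
  using norm_powr_real_powr[of "of_nat n" s] by simp

lemma prod_mset_powr:
  fixes s :: complex
  shows "(\<Prod>p\<in>#A. of_nat p powr s) = of_nat (\<Prod>p\<in>#A. p) powr s"
  by (induction A) (auto simp: powr_times_real)

lemma mult_ext_powr:
  fixes s :: complex
  assumes "n > 0"
  shows "mult_ext (\<lambda>p. of_nat p powr s) n = of_nat n powr s"
proof -
  have "(\<Prod>p\<in>#prime_factorization n. p) = n"
    using assms by simp
  then show ?thesis
    using prod_mset_powr[where A = "prime_factorization n" and s = s] by (simp add: mult_ext_def)
qed

lemma power_sum_mset: "u ^ (\<Sum>p\<in>#A. k p) = (\<Prod>p\<in>#A. u ^ k p)" for u :: "'a::comm_semiring_1"
  by (induction A) (auto simp: power_add)

lemma mult_ext_prime_power: "prime q \<Longrightarrow> mult_ext z (q ^ k) = z q ^ k"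
  by (simp add: mult_ext_def prime_factorization_prime_power)

text \<open>
A partial Euler product: writing \<open>n = m * q ^ k\<close> with \<open>q\<close> not dividing \<open>m\<close> splits off one prime \<open>q\<close> and
its geometric series at a time.
\<close>

lemma sum_mult_ext_smooth_le:
  fixes x :: "nat \<Rightarrow> real"
  assumes "finite P" and "\<And>p. p \<in> P \<Longrightarrow> prime p" and x: "\<And>p. prime p \<Longrightarrow> 0 \<le> x p \<and> x p < 1"
  shows "(\<Sum>n | 0 < n \<and> n \<le> X \<and> prime_factors n \<subseteq> P. mult_ext x n) \<le> (\<Prod>p\<in>P. 1 / (1 - x p))"
  using assms(1,2)
proof (induction P)
  case empty
  have "{n::nat. 0 < n \<and> n \<le> X \<and> prime_factors n \<subseteq> {}} \<subseteq> {1}"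
    by (auto simp: prime_factorization_empty_iff)
  then have "(\<Sum>n | 0 < n \<and> n \<le> X \<and> prime_factors n \<subseteq> {}. mult_ext x n) \<le> (\<Sum>n\<in>{1}. mult_ext x n)"
    by (intro sum_mono2) (auto intro: mult_ext_nonneg simp: x)
  then show ?case by simp
next
  case (insert q P)
  have q: "prime q" and xq: "0 \<le> x q" "x q < 1" using insert.prems x by auto
  define S where "S Q = {n::nat. 0 < n \<and> n \<le> X \<and> prime_factors n \<subseteq> Q}" for Q
  have fin: "finite (S Q)" for Q unfolding S_def by (rule finite_subset[of _ "{..X}"]) auto
  have "S (insert q P) \<subseteq> (\<lambda>(m, k). m * q ^ k) ` (S P \<times> {..X})"
  proof
    fix n assume n: "n \<in> S (insert q P)"
    then have n0: "n > 0" "n \<le> X" and pf: "prime_factors n \<subseteq> insert q P" by (auto simp: S_def)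
    obtain m where m: "n = q ^ multiplicity q n * m" "\<not> q dvd m"
      using multiplicity_decompose'[of n q] n0 not_prime_1 q by (metis neq0_conv not_prime_unit)
    have m0: "m > 0" using m(2) by (cases "m = 0") auto
    have "m dvd n" using m(1) dvd_triv_right[of m "q ^ multiplicity q n"] by argo
    then have "m \<le> X" using n0 by (meson dvd_imp_le le_trans)
    moreover have "prime_factors m \<subseteq> P"
      using \<open>m dvd n\<close> pf m(2) n0 dvd_prime_factors[of n m] by (auto simp: in_prime_factors_iff)
    moreover have "multiplicity q n \<le> X"
    proof -
      have "multiplicity q n < 2 ^ multiplicity q n" by (rule less_exp)
      also have "\<dots> \<le> q ^ multiplicity q n" using q by (intro power_mono) (auto dest: prime_ge_2_nat)
      also have "\<dots> \<le> n" using n0 by (intro dvd_imp_le multiplicity_dvd) auto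
      finally show ?thesis using n0 by simp
    qed
    ultimately show "n \<in> (\<lambda>(m, k). m * q ^ k) ` (S P \<times> {..X})"
      using m m0 by (intro image_eqI[of _ _ "(m, multiplicity q n)"]) (auto simp: S_def mult.commute)
  qed
  then have "(\<Sum>n\<in>S (insert q P). mult_ext x n)
      \<le> (\<Sum>n\<in>(\<lambda>(m, k). m * q ^ k) ` (S P \<times> {..X}). mult_ext x n)"
    using fin by (intro sum_mono2) (auto intro: mult_ext_nonneg simp: x)
  also have "\<dots> \<le> (\<Sum>y\<in>S P \<times> {..X}. mult_ext x ((\<lambda>(m, k). m * q ^ k) y))"
    using sum_image_le[of "S P \<times> {..X}" "mult_ext x" "\<lambda>(m, k). m * q ^ k"] fin
    by (simp add: mult_ext_nonneg x o_def)
  also have "\<dots> = (\<Sum>y\<in>S P \<times> {..X}. mult_ext x (fst y) * x q ^ snd y)"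
    using q by (intro sum.cong refl)
      (auto simp: S_def mult_ext_mult mult_ext_prime_power prime_gt_0_nat)
  also have "\<dots> = (\<Sum>m\<in>S P. mult_ext x m) * (\<Sum>k\<le>X. x q ^ k)"
    by (simp add: sum_product sum.cartesian_product case_prod_unfold)
  also have "\<dots> \<le> (\<Prod>p\<in>P. 1 / (1 - x p)) * (1 / (1 - x q))"
  proof (rule mult_mono)
    show "(\<Sum>m\<in>S P. mult_ext x m) \<le> (\<Prod>p\<in>P. 1 / (1 - x p))"
      using insert.IH insert.prems by (simp add: S_def)
    have "(\<Sum>k\<le>X. x q ^ k) = (1 - x q ^ Suc X) / (1 - x q)"
      using xq sum_gp0[of "x q" X] by simp
    also have "\<dots> \<le> 1 / (1 - x q)" using xq by (intro divide_right_mono) auto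
    finally show "(\<Sum>k\<le>X. x q ^ k) \<le> 1 / (1 - x q)" .
    show "0 \<le> (\<Prod>p\<in>P. 1 / (1 - x p))"
      using insert.prems x by (intro prod_nonneg) (auto simp: less_imp_le)
    show "0 \<le> (\<Sum>k\<le>X. x q ^ k)" using xq by (intro sum_nonneg) auto
  qed
  also have "\<dots> = (\<Prod>p\<in>insert q P. 1 / (1 - x p))"
    using insert.hyps by simp
  finally show ?case by (simp add: S_def)
qed

lemma summable_mult_ext:
  fixes z :: "nat \<Rightarrow> complex"
  assumes "finite {p. prime p \<and> z p \<noteq> 0}" and "\<And>p. prime p \<Longrightarrow> norm (z p) < 1"
  shows "(\<lambda>n. norm (mult_ext z n)) summable_on {1..}"
proof (rule nonneg_bdd_above_summable_on)
  define P where "P = {p. prime p \<and> z p \<noteq> 0}"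
  show "bdd_above (sum (\<lambda>n. norm (mult_ext z n)) ` {F. F \<subseteq> {1..} \<and> finite F})"
  proof (rule bdd_aboveI, safe)
    fix F :: "nat set" assume F: "F \<subseteq> {1..}" "finite F"
    define G where "G = {n. 0 < n \<and> n \<le> Max (insert 0 F) \<and> prime_factors n \<subseteq> P}"
    have "finite G" unfolding G_def by (rule finite_subset[of _ "{..Max (insert 0 F)}"]) auto
    have "mult_ext z n = 0" if "n \<in> F - G" for n
    proof -
      have "0 < n" "n \<le> Max (insert 0 F)" using that F by auto
      then have "\<not> prime_factors n \<subseteq> P" using that by (simp add: G_def)
      then obtain p where "p \<in> prime_factors n" "p \<notin> P" by blast
      then show ?thesis by (intro mult_ext_zero[of p]) (auto simp: P_def)
    qed
    then have "(\<Sum>n\<in>F. norm (mult_ext z n)) = (\<Sum>n\<in>F \<inter> G. norm (mult_ext z n))"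
      using F by (intro sum.mono_neutral_right) auto
    also have "\<dots> \<le> (\<Sum>n\<in>G. norm (mult_ext z n))"
      using \<open>finite G\<close> by (intro sum_mono2) auto
    also have "\<dots> \<le> (\<Prod>p\<in>P. 1 / (1 - norm (z p)))"
      unfolding G_def norm_mult_ext using assms by (intro sum_mult_ext_smooth_le) (auto simp: P_def)
    finally show "(\<Sum>n\<in>F. norm (mult_ext z n)) \<le> (\<Prod>p\<in>P. 1 / (1 - norm (z p)))" .
  qed
qed (rule norm_ge_zero)

section \<open>Bohr's correspondence for Dirichlet polynomials\<close>

text \<open>
Unique factorisation, written additively: exponentiating the relation gives two factorisations of
one natural number.
\<close>

lemma prime_logs_independent:
  fixes c :: "nat \<Rightarrow> int"
  assumes "finite P" and P: "\<And>p. p \<in> P \<Longrightarrow> prime p"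
    and sum0: "(\<Sum>p\<in>P. of_int (c p) * ln (real p)) = 0" and "q \<in> P"
  shows "c q = 0"
proof -
  define A where "A = (\<Prod>p\<in>P. p ^ nat (c p))"
  define B where "B = (\<Prod>p\<in>P. p ^ nat (- c p))"
  have pos: "p > 0" if "p \<in> P" for p using P[OF that] by (simp add: prime_gt_0_nat)
  have ln_prod_pow: "ln (real (\<Prod>p\<in>P. p ^ e p)) = (\<Sum>p\<in>P. real (e p) * ln (real p))" for e
    using pos \<open>finite P\<close> by (simp add: ln_prod ln_realpow)
  have "ln (real A) - ln (real B) = (\<Sum>p\<in>P. (real (nat (c p)) - real (nat (- c p))) * ln (real p))"
    unfolding A_def B_def ln_prod_pow by (simp add: sum_subtractf left_diff_distrib)
  also have "\<dots> = (\<Sum>p\<in>P. of_int (c p) * ln (real p))"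
    by (intro sum.cong refl) auto
  finally have "ln (real A) = ln (real B)" using sum0 by simp
  moreover have "A > 0" "B > 0" using pos \<open>finite P\<close> by (auto simp: A_def B_def intro!: prod_pos)
  ultimately have "A = B" by simp
  then have "multiplicity q A = multiplicity q B" by simp
  then have "nat (c q) = nat (- c q)"
    unfolding A_def B_def using assms by (simp add: multiplicity_prod_prime_powers)
  then show ?thesis by linarith
qed

lemma norm_cis_diff_le: "norm (cis a - cis b) \<le> \<bar>a - b\<bar>"
proof -
  have "cis a - cis b = cis b * (exp (\<i> * of_real (a - b)) - 1)"
    by (simp add: cis_conv_exp right_diff_distrib exp_diff)
  then have "norm (cis a - cis b) = norm (exp (\<i> * of_real (a - b)) - 1)"
    by (simp add: norm_mult)
  also have "\<dots> = 2 * \<bar>sin ((a - b) / 2)\<bar>"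
    using dist_exp_i_1[of "a - b"] by simp
  also have "\<dots> \<le> \<bar>a - b\<bar>"
    using abs_sin_x_le_abs_x[of "(a - b) / 2"] by simp
  finally show ?thesis .
qed

lemma powr_imaginary_cis:
  assumes "n > 0"
  shows "complex_of_nat n powr (\<i> * of_real t) = cis (t * ln (real n))"
  using assms by (simp add: powr_def cis_conv_exp Ln_of_nat mult_ac)

text \<open>
Kronecker's theorem for the frequencies \<open>ln p / (2 * pi)\<close>.
\<close>

lemma kronecker_primes:
  fixes z :: "nat \<Rightarrow> complex"
  assumes "finite P" and P: "\<And>p. p \<in> P \<Longrightarrow> prime p" and z: "\<And>p. p \<in> P \<Longrightarrow> norm (z p) = 1"
    and "\<epsilon> > 0"
  shows "\<exists>t::real. \<forall>p\<in>P. norm (of_nat p powr (\<i> * of_real t) - z p) < \<epsilon>"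
proof -
  obtain e where e: "bij_betw e {..<card P} P"
    using ex_bij_betw_nat_finite[OF \<open>finite P\<close>] by (auto simp: atLeast0LessThan)
  define \<theta> where "\<theta> i = ln (real (e i)) / (2 * pi)" for i
  define \<alpha> where "\<alpha> i = Arg (z (e i)) / (2 * pi)" for i
  have eP: "e i \<in> P" if "i < card P" for i using e that by (auto simp: bij_betw_def)
  have pos: "0 < p" if "p \<in> P" for p using P[OF that] by (simp add: prime_gt_0_nat)
  have inj: "inj_on \<theta> {..<card P}"
  proof (rule inj_onI)
    fix i j assume ij: "i \<in> {..<card P}" "j \<in> {..<card P}" "\<theta> i = \<theta> j"
    then have "e i = e j" using pos eP by (simp add: \<theta>_def)
    then show "i = j" using e ij by (auto simp: bij_betw_def inj_on_def)
  qed
  interpret Modules.module "(\<lambda>r. (*) (real_of_int r))"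
    by (simp add: Modules.module.intro distrib_left mult.commute)
  have indep: "independent (\<theta> ` {..<card P})"
  proof
    assume "dependent (\<theta> ` {..<card P})"
    then obtain u v where v: "v \<in> \<theta> ` {..<card P}" "u v \<noteq> 0"
      and s: "(\<Sum>v\<in>\<theta> ` {..<card P}. real_of_int (u v) * v) = 0"
      by (auto simp: dependent_finite)
    define c where "c p = u (ln (real p) / (2 * pi))" for p
    have "(\<Sum>p\<in>P. of_int (c p) * ln (real p)) = (\<Sum>i<card P. of_int (c (e i)) * ln (real (e i)))"
      by (rule sum.reindex_bij_betw[OF e, symmetric])
    also have "\<dots> = 2 * pi * (\<Sum>i<card P. of_int (u (\<theta> i)) * \<theta> i)"
      by (simp add: c_def \<theta>_def sum_distrib_left)
    also have "(\<Sum>i<card P. of_int (u (\<theta> i)) * \<theta> i) = 0"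
      using s by (simp add: sum.reindex[OF inj])
    finally have s0: "(\<Sum>p\<in>P. of_int (c p) * ln (real p)) = 0" by simp
    obtain i where i: "i < card P" "v = \<theta> i" using v by auto
    have "c (e i) = 0"
      by (rule prime_logs_independent[OF \<open>finite P\<close> P s0 eP]) (use i in auto)
    then show False using v i by (simp add: c_def \<theta>_def)
  qed
  obtain t h where th: "\<And>i. i < card P \<Longrightarrow> \<bar>t * \<theta> i - of_int (h i) - \<alpha> i\<bar> < \<epsilon> / (2 * pi)"
    using Kronecker_thm_1[OF indep inj, of "\<epsilon> / (2 * pi)" \<alpha>] \<open>\<epsilon> > 0\<close> by auto
  have "norm (of_nat p powr (\<i> * of_real t) - z p) < \<epsilon>" if "p \<in> P" for p
  proof -
    have "p \<in> e ` {..<card P}" using that bij_betw_imp_surj_on[OF e] by simp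
    then obtain i where i: "i < card P" "p = e i" by auto
    have "z p = cis (2 * pi * \<alpha> i)"
      using z[OF that] i rcis_cmod_Arg[of "z p"] by (simp add: \<alpha>_def rcis_def)
    also have "\<dots> = cis (2 * pi * \<alpha> i + 2 * pi * of_int (h i))"
      using cis_multiple_2pi[of "of_int (h i)"] by (simp add: cis_mult[symmetric])
    finally have "norm (of_nat p powr (\<i> * of_real t) - z p)
        \<le> \<bar>t * ln (real p) - (2 * pi * \<alpha> i + 2 * pi * of_int (h i))\<bar>"
      using norm_cis_diff_le pos[OF that] by (simp add: powr_imaginary_cis)
    also have "\<dots> = 2 * pi * \<bar>t * \<theta> i - of_int (h i) - \<alpha> i\<bar>"
    proof -
      have "t * ln (real p) - (2 * pi * \<alpha> i + 2 * pi * of_int (h i))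
          = 2 * pi * (t * \<theta> i - of_int (h i) - \<alpha> i)"
        using i by (simp add: \<theta>_def right_diff_distrib)
      then show ?thesis by (simp add: abs_mult)
    qed
    also have "\<dots> < \<epsilon>" using th[OF i(1)] by (simp add: field_simps)
    finally show ?thesis .
  qed
  then show ?thesis by blast
qed

lemma tendsto_mult_ext:
  fixes z :: "nat \<Rightarrow> complex"
  assumes "\<And>p. p \<in> prime_factors n \<Longrightarrow> ((\<lambda>k. w k p) \<longlongrightarrow> z p) F"
  shows "((\<lambda>k. mult_ext (w k) n) \<longlongrightarrow> mult_ext z n) F"
proof -
  have "((\<lambda>k. \<Prod>p\<in>#A. w k p) \<longlongrightarrow> (\<Prod>p\<in>#A. z p)) F" if "set_mset A \<subseteq> prime_factors n" for A
    using that by (induction A) (auto intro!: tendsto_mult assms)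
  from this[of "prime_factorization n"] show ?thesis by (simp add: mult_ext_def)
qed

lemma holomorphic_mult_ext: "(\<lambda>w. mult_ext (z(q := w)) n) holomorphic_on S"
proof -
  have "(\<lambda>w. \<Prod>p\<in>#A. (z(q := w)) p) holomorphic_on S" for A
  proof (induction A)
    case (add p A)
    then show ?case by (cases "p = q") (auto intro!: holomorphic_intros)
  qed simp
  from this[of "prime_factorization n"] show ?thesis by (simp add: mult_ext_def)
qed

text \<open>
The point \<open>z\<close> of the torus is a limit of points \<open>p powr (\<i> * t)\<close>, in the finitely many coordinates on
which the polynomial depends.
\<close>

lemma bohr_correspondence_torus:
  fixes z :: "nat \<Rightarrow> complex"
  assumes B: "\<And>t::real. norm (\<Sum>n=1..N. c n * of_nat n powr (\<i> * of_real t)) \<le> B"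
    and z: "\<And>p. prime p \<Longrightarrow> norm (z p) = 1"
  shows "norm (\<Sum>n=1..N. c n * mult_ext z n) \<le> B"
proof -
  define P where "P = {p. prime p \<and> p \<le> N}"
  have "finite P" unfolding P_def by (rule finite_subset[of _ "{..N}"]) auto
  have "\<exists>t::real. \<forall>p\<in>P. norm (of_nat p powr (\<i> * of_real t) - z p) < 1 / real (Suc k)" for k
    by (rule kronecker_primes) (use \<open>finite P\<close> z in \<open>auto simp: P_def\<close>)
  then obtain t :: "nat \<Rightarrow> real"
    where t: "\<And>k p. p \<in> P \<Longrightarrow> norm (of_nat p powr (\<i> * of_real (t k)) - z p) < 1 / real (Suc k)"
    by metis
  have lim: "(\<lambda>k. of_nat p powr (\<i> * of_real (t k))) \<longlonglongrightarrow> z p" if "p \<in> P" for p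
  proof (rule LIM_zero_cancel, rule Lim_null_comparison)
    show "\<forall>\<^sub>F k in sequentially. norm (of_nat p powr (\<i> * of_real (t k)) - z p) \<le> 1 / real (Suc k)"
      using t[OF that] by (intro always_eventually allI less_imp_le) 
    show "(\<lambda>k. 1 / real (Suc k)) \<longlonglongrightarrow> 0" by (rule lim_1_over_n[THEN LIMSEQ_Suc])
  qed
  have "(\<lambda>k. \<Sum>n=1..N. c n * mult_ext (\<lambda>p. of_nat p powr (\<i> * of_real (t k))) n)
      \<longlonglongrightarrow> (\<Sum>n=1..N. c n * mult_ext z n)"
  proof (intro tendsto_sum tendsto_mult tendsto_const tendsto_mult_ext lim)
    fix n p assume "n \<in> {1..N}" "p \<in> prime_factors n"
    then show "p \<in> P" by (auto simp: P_def in_prime_factors_iff dest: dvd_imp_le)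
  qed
  then show ?thesis
    using B by (intro Lim_norm_ubound[OF sequentially_bot]) (auto simp: mult_ext_powr)
qed

text \<open>
The coordinates are moved from the unit circle into the unit disc one by one. When one of them
moves, the polynomial is holomorphic in it and the maximum modulus principle applies.
\<close>

lemma bohr_correspondence:
  fixes z :: "nat \<Rightarrow> complex"
  assumes B: "\<And>t::real. norm (\<Sum>n=1..N. c n * of_nat n powr (\<i> * of_real t)) \<le> B"
    and z: "\<And>p. prime p \<Longrightarrow> norm (z p) \<le> 1"
  shows "norm (\<Sum>n=1..N. c n * mult_ext z n) \<le> B"
proof -
  have *: "norm (\<Sum>n=1..N. c n * mult_ext z n) \<le> B"
    if "finite Q" "\<And>p. prime p \<Longrightarrow> norm (z p) \<le> 1" "\<And>p. prime p \<Longrightarrow> p \<notin> Q \<Longrightarrow> norm (z p) = 1"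
    for Q and z :: "nat \<Rightarrow> complex"
    using that
  proof (induction Q arbitrary: z)
    case empty
    then show ?case by (intro bohr_correspondence_torus[OF B]) auto
  next
    case (insert q Q)
    let ?f = "\<lambda>w. \<Sum>n=1..N. c n * mult_ext (z(q := w)) n"
    have hol: "?f holomorphic_on UNIV" by (intro holomorphic_intros holomorphic_mult_ext)
    show ?case
    proof (cases "prime q")
      case False
      then show ?thesis using insert.prems by (intro insert.IH) auto
    next
      case True
      have "norm (?f (z q)) \<le> B"
      proof (rule maximum_modulus_frontier[where f = ?f and \<xi> = "z q" and S = "cball 0 1"])
        show "?f holomorphic_on interior (cball 0 1)" using hol by (rule holomorphic_on_subset) auto
        show "continuous_on (closure (cball 0 1)) ?f"
          using hol by (intro holomorphic_on_imp_continuous_on) (rule holomorphic_on_subset, auto)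
        show "norm (?f w) \<le> B" if "w \<in> frontier (cball 0 1)" for w
          using that insert.prems by (intro insert.IH) auto
      qed (use True insert.prems in auto)
      then show ?thesis by simp
    qed
  qed
  \<comment> \<open>The polynomial does not involve primes above \<open>N\<close>, so these coordinates may be put on the circle.\<close>
  define z' where "z' p = (if p \<le> N then z p else 1)" for p
  have "(\<Sum>n=1..N. c n * mult_ext z' n) = (\<Sum>n=1..N. c n * mult_ext z n)"
  proof (intro sum.cong refl arg_cong2[where f = "(*)"] mult_ext_cong)
    fix n p assume "n \<in> {1..N}" "p \<in> prime_factors n"
    then have "p \<le> N" by (auto simp: in_prime_factors_iff dest: dvd_imp_le)
    then show "z' p = z p" by (simp add: z'_def)
  qed
  moreover have "norm (\<Sum>n=1..N. c n * mult_ext z' n) \<le> B"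
    using z by (intro *[of "{..N}"]) (auto simp: z'_def)
  ultimately show ?thesis by simp
qed

section \<open>Boundedness on the infinite polydisc\<close>

text \<open>
Points with finitely many nonzero coordinates suffice to detect the size of a series, and at such points
absolute convergence is automatic for coefficients of polynomial growth. Absolute convergence
is encoded by unordered summability, which makes the condition manifestly independent of the
order of the indices.
\<close>

definition bohr_bounded :: "(nat \<Rightarrow> complex) \<Rightarrow> real \<Rightarrow> bool" where
  "bohr_bounded a M \<longleftrightarrow>
     (\<forall>z. finite {p. prime p \<and> z p \<noteq> 0} \<longrightarrow> (\<forall>p. prime p \<longrightarrow> norm (z p) < 1) \<longrightarrow>
        (\<lambda>n. a n * mult_ext z n) summable_on {1..} \<and>
        norm (\<Sum>\<^sub>\<infinity>n\<in>{1..}. a n * mult_ext z n) \<le> M)"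

lemma bohr_boundedD:
  assumes "bohr_bounded a M" "finite {p. prime p \<and> z p \<noteq> 0}" "\<And>p. prime p \<Longrightarrow> norm (z p) < 1"
  shows "(\<lambda>n. a n * mult_ext z n) summable_on {1..}"
    and "norm (\<Sum>\<^sub>\<infinity>n\<in>{1..}. a n * mult_ext z n) \<le> M"
  using assms by (auto simp: bohr_bounded_def)

lemma bohr_bounded_nonneg: "bohr_bounded a M \<Longrightarrow> 0 \<le> M"
  using order_trans[OF norm_ge_zero bohr_boundedD(2)[of a M "\<lambda>_. 0"]] by simp

lemma bohr_bounded_cong:
  assumes "bohr_bounded a M" "\<And>n. 0 < n \<Longrightarrow> a n = b n"
  shows "bohr_bounded b M"
proof -
  have "(\<lambda>n. a n * mult_ext z n) summable_on {1..} \<longleftrightarrow> (\<lambda>n. b n * mult_ext z n) summable_on {1..}"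
    "(\<Sum>\<^sub>\<infinity>n\<in>{1..}. a n * mult_ext z n) = (\<Sum>\<^sub>\<infinity>n\<in>{1..}. b n * mult_ext z n)" for z
    using assms(2) by (auto intro!: summable_on_cong infsum_cong)
  then show ?thesis using assms(1) by (simp add: bohr_bounded_def)
qed

lemma bohr_bounded_add:
  assumes "bohr_bounded a M" "bohr_bounded b M'"
  shows "bohr_bounded (\<lambda>n. a n + b n) (M + M')"
  unfolding bohr_bounded_def
proof (intro allI impI conjI)
  fix z :: "nat \<Rightarrow> complex"
  assume z: "finite {p. prime p \<and> z p \<noteq> 0}" "\<forall>p. prime p \<longrightarrow> norm (z p) < 1"
  note a = bohr_boundedD[OF assms(1) z(1)] and b = bohr_boundedD[OF assms(2) z(1)]
  show "(\<lambda>n. (a n + b n) * mult_ext z n) summable_on {1..}"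
    using a b z by (simp add: distrib_right summable_on_add)
  have "(\<Sum>\<^sub>\<infinity>n\<in>{1..}. (a n + b n) * mult_ext z n)
      = (\<Sum>\<^sub>\<infinity>n\<in>{1..}. a n * mult_ext z n) + (\<Sum>\<^sub>\<infinity>n\<in>{1..}. b n * mult_ext z n)"
    using a b z by (simp add: distrib_right infsum_add)
  then show "norm (\<Sum>\<^sub>\<infinity>n\<in>{1..}. (a n + b n) * mult_ext z n) \<le> M + M'"
    using norm_triangle_mono[OF a(2) b(2)] z by simp
qed

text \<open>
Replacing \<open>z p\<close> by \<open>w p * z p\<close> stays inside the polydisc. Vertical shifts into the half-plane
(\<open>w p = p powr (-\<epsilon>)\<close>), dilations (\<open>w p = r\<close>) and the restriction to smooth indices
(\<open>w p \<in> {0, 1}\<close>) all have this form.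
\<close>

lemma bohr_bounded_multiplier:
  assumes "bohr_bounded a M" and w: "\<And>p. prime p \<Longrightarrow> norm (w p) \<le> 1"
  shows "bohr_bounded (\<lambda>n. mult_ext w n * a n) M"
  unfolding bohr_bounded_def
proof (intro allI impI)
  fix z :: "nat \<Rightarrow> complex"
  assume z: "finite {p. prime p \<and> z p \<noteq> 0}" "\<forall>p. prime p \<longrightarrow> norm (z p) < 1"
  have "finite {p. prime p \<and> w p * z p \<noteq> 0}" using z(1) by (rule finite_subset[rotated]) auto
  moreover have "norm (w p * z p) < 1" if "prime p" for p
  proof -
    have "norm (w p * z p) \<le> 1 * norm (z p)"
      unfolding norm_mult using w[OF that] by (intro mult_right_mono) auto
    also have "\<dots> < 1" using z(2) that by simp
    finally show ?thesis .
  qed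
  ultimately show "(\<lambda>n. mult_ext w n * a n * mult_ext z n) summable_on {1..} \<and>
      norm (\<Sum>\<^sub>\<infinity>n\<in>{1..}. mult_ext w n * a n * mult_ext z n) \<le> M"
    using bohr_boundedD[OF assms(1), of "\<lambda>p. w p * z p"] by (simp add: mult_ext_distrib mult_ac)
qed

lemma bohr_bounded_summable:
  assumes "summable (\<lambda>n. norm (c n))"
  shows "bohr_bounded c (\<Sum>n. norm (c n))"
  unfolding bohr_bounded_def
proof (intro allI impI conjI)
  fix z :: "nat \<Rightarrow> complex"
  assume z: "finite {p. prime p \<and> z p \<noteq> 0}" "\<forall>p. prime p \<longrightarrow> norm (z p) < 1"
  have cUNIV: "((\<lambda>n. norm (c n)) has_sum (\<Sum>n. norm (c n))) UNIV"
    using assms by (intro norm_summable_imp_has_sum summable_sums) auto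
  then have c: "(\<lambda>n. norm (c n)) summable_on {1..}"
    by (meson has_sum_imp_summable subset_UNIV summable_on_subset_banach)
  have le: "norm (c n * mult_ext z n) \<le> norm (c n)" for n
    unfolding norm_mult using z by (intro mult_left_le norm_mult_ext_le_1) (auto simp: less_imp_le)
  have abs: "(\<lambda>n. norm (c n * mult_ext z n)) summable_on {1..}"
    by (rule summable_on_comparison_test[OF c]) (auto simp: le)
  then show "(\<lambda>n. c n * mult_ext z n) summable_on {1..}"
    by (rule abs_summable_summable)
  have "norm (\<Sum>\<^sub>\<infinity>n\<in>{1..}. c n * mult_ext z n) \<le> (\<Sum>\<^sub>\<infinity>n\<in>{1..}. norm (c n))"
    using norm_infsum_bound[OF abs] infsum_mono[OF abs c le] by simp
  also have "\<dots> \<le> (\<Sum>\<^sub>\<infinity>n\<in>UNIV. norm (c n))"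
    using c cUNIV by (intro infsum_mono_neutral) (auto simp: has_sum_imp_summable)
  also have "\<dots> = (\<Sum>n. norm (c n))" using cUNIV by (rule infsumI)
  finally show "norm (\<Sum>\<^sub>\<infinity>n\<in>{1..}. c n * mult_ext z n) \<le> (\<Sum>n. norm (c n))" .
qed

lemma has_sum_initial_segments:
  fixes f :: "nat \<Rightarrow> 'a::{comm_monoid_add, topological_space}"
  assumes "(f has_sum S) {1..}"
  shows "(\<lambda>N. \<Sum>n=1..N. f n) \<longlonglongrightarrow> S"
proof -
  have "filterlim (\<lambda>N. {1..N}) (finite_subsets_at_top {1::nat..}) sequentially"
    unfolding filterlim_finite_subsets_at_top
  proof (intro allI impI)
    fix X :: "nat set" assume X: "finite X \<and> X \<subseteq> {1..}"
    then show "\<forall>\<^sub>F N in sequentially. finite {1..N} \<and> X \<subseteq> {1..N} \<and> {1..N} \<subseteq> {1..}"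
      by (intro eventually_sequentiallyI[of "Max (insert 0 X)"]) (auto intro: order_trans[OF Max_ge])
  qed
  then show ?thesis using assms unfolding has_sum_def by (rule filterlim_compose[rotated])
qed

text \<open>
Each term is a difference of two consecutive partial sums, which converge.
\<close>

lemma dirichlet_coeff_bound:
  assumes "dirichlet_converges_to a f" "\<epsilon> > 0"
  obtains C where "\<And>n. n > 0 \<Longrightarrow> norm (a n) * real n powr (- \<epsilon>) \<le> C"
proof -
  have "uniform_limit {s. \<epsilon> / 2 < Re s} (dirichlet_partial_sum a) f sequentially"
    using assms unfolding dirichlet_converges_to_def by (meson half_gt_zero)
  then have lim: "(\<lambda>N. dirichlet_partial_sum a N (of_real \<epsilon>)) \<longlonglongrightarrow> f (of_real \<epsilon>)"
    by (rule tendsto_uniform_limitI) (use assms in auto)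
  have "Bseq (\<lambda>N. dirichlet_partial_sum a N (of_real \<epsilon>))"
    using lim by (intro convergent_imp_Bseq convergentI)
  then obtain K where "\<forall>N. norm (dirichlet_partial_sum a N (of_real \<epsilon>)) \<le> K"
    by (rule BseqE)
  then have K: "norm (dirichlet_partial_sum a N (of_real \<epsilon>)) \<le> K" for N by simp
  have "norm (a n) * real n powr (- \<epsilon>) \<le> 2 * K" if "n > 0" for n
  proof -
    obtain m where n: "n = Suc m" using \<open>n > 0\<close> gr0_implies_Suc by blast
    have "a n * of_nat n powr (- of_real \<epsilon>)
        = dirichlet_partial_sum a n (of_real \<epsilon>) - dirichlet_partial_sum a m (of_real \<epsilon>)"
      by (simp add: dirichlet_partial_sum_def n)
    then have "norm (a n * of_nat n powr (- of_real \<epsilon>)) \<le> K + K"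
      using norm_triangle_le_diff[OF add_mono[OF K K]] by simp
    moreover have "norm (complex_of_nat n powr (- of_real \<epsilon>)) = real n powr (- \<epsilon>)"
      by (simp add: norm_nat_powr)
    ultimately show ?thesis by (simp add: norm_mult)
  qed
  then show ?thesis by (rule that)
qed

text \<open>
Only finitely many coordinates of \<open>z\<close> are nonzero, so there is room to write
\<open>z p = w p * p powr (-\<epsilon>)\<close> with \<open>w\<close> still in the polydisc. The factor \<open>p powr (-\<epsilon>)\<close> moves the
partial sums to the line \<open>Re s = \<epsilon>\<close>, where they are uniformly close to \<open>f\<close>, and Bohr's
correspondence carries the bound \<open>M + \<eta>\<close> over to \<open>w\<close>.
\<close>

lemma bohr_bounded_of_limit:
  assumes conv: "dirichlet_converges_to a f" and M: "\<And>s. 0 < Re s \<Longrightarrow> norm (f s) \<le> M"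
  shows "bohr_bounded a M"
  unfolding bohr_bounded_def
proof (intro allI impI)
  fix z :: "nat \<Rightarrow> complex"
  assume z: "finite {p. prime p \<and> z p \<noteq> 0}" "\<forall>p. prime p \<longrightarrow> norm (z p) < 1"
  define P where "P = {p. prime p \<and> z p \<noteq> 0}"
  have "\<forall>\<^sub>F \<epsilon> in at_right 0. norm (z p) * real p powr \<epsilon> < 1" if "p \<in> P" for p
  proof -
    have "((\<lambda>\<epsilon>. norm (z p) * real p powr \<epsilon>) \<longlongrightarrow> norm (z p) * real p powr 0) (at_right 0)"
      using prime_gt_0_nat[of p] that
      by (intro tendsto_mult[OF tendsto_const tendsto_powr[OF tendsto_const tendsto_ident_at]])
        (simp add: P_def)
    moreover have "norm (z p) * real p powr 0 < 1"
      using that z(2) by (auto simp: P_def)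
    ultimately show ?thesis by (rule order_tendstoD(2))
  qed
  then have "\<forall>\<^sub>F \<epsilon> in at_right 0. \<forall>p\<in>P. norm (z p) * real p powr \<epsilon> < 1"
    using z(1) unfolding P_def by (intro eventually_ball_finite) auto
  moreover have "\<forall>\<^sub>F \<epsilon>::real in at_right 0. \<epsilon> > 0" by (rule eventually_at_right_less)
  ultimately obtain \<epsilon> where "\<epsilon> > 0" and \<epsilon>: "\<forall>p\<in>P. norm (z p) * real p powr \<epsilon> < 1"
    using eventually_conj eventually_happens'[OF trivial_limit_at_right_real] by blast
  define w where "w p = z p * of_nat p powr of_real \<epsilon>" for p
  have w1: "norm (w p) < 1" if "prime p" for p
    using that \<epsilon> by (cases "p \<in> P") (auto simp: w_def norm_mult norm_nat_powr P_def)
  have wfin: "finite {p. prime p \<and> w p \<noteq> 0}"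
    using z(1) by (rule finite_subset[rotated]) (auto simp: w_def)
  have wz: "of_nat n powr (- of_real \<epsilon>) * mult_ext w n = mult_ext z n" if "n > 0" for n
  proof -
    have "mult_ext w n = mult_ext z n * of_nat n powr of_real \<epsilon>"
      using that by (simp add: w_def[abs_def] mult_ext_distrib mult_ext_powr)
    then show ?thesis using that by (simp add: powr_minus)
  qed
  obtain C where C: "\<And>n. n > 0 \<Longrightarrow> norm (a n) * real n powr (- \<epsilon>) \<le> C"
    using dirichlet_coeff_bound[OF conv \<open>\<epsilon> > 0\<close>] by blast
  have summ: "(\<lambda>n. a n * mult_ext z n) summable_on {1..}"
  proof (rule abs_summable_summable, rule summable_on_comparison_test)
    show "(\<lambda>n. C * norm (mult_ext w n)) summable_on {1..}"
      by (intro summable_on_cmult_right summable_mult_ext wfin w1)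
    show "norm (a n * mult_ext z n) \<le> C * norm (mult_ext w n)" if "n \<in> {1..}" for n
    proof -
      have "norm (a n * mult_ext z n) = norm (a n) * real n powr (- \<epsilon>) * norm (mult_ext w n)"
        using that by (simp add: wz[symmetric] norm_mult norm_nat_powr)
      also have "\<dots> \<le> C * norm (mult_ext w n)" using C[of n] that by (intro mult_right_mono) auto
      finally show ?thesis .
    qed
  qed auto
  have "norm (\<Sum>\<^sub>\<infinity>n\<in>{1..}. a n * mult_ext z n) \<le> M + \<eta>" if "\<eta> > 0" for \<eta>
  proof (rule Lim_norm_ubound[OF sequentially_bot])
    show "(\<lambda>N. \<Sum>n=1..N. a n * mult_ext z n) \<longlonglongrightarrow> (\<Sum>\<^sub>\<infinity>n\<in>{1..}. a n * mult_ext z n)"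
      using summ by (intro has_sum_initial_segments has_sum_infsum)
    have "uniform_limit {s. \<epsilon> / 2 < Re s} (dirichlet_partial_sum a) f sequentially"
      using conv \<open>\<epsilon> > 0\<close> unfolding dirichlet_converges_to_def by (meson half_gt_zero)
    then have "\<forall>\<^sub>F N in sequentially. \<forall>s\<in>{s. \<epsilon> / 2 < Re s}. dist (dirichlet_partial_sum a N s) (f s) < \<eta>"
      using \<open>\<eta> > 0\<close> unfolding uniform_limit_iff by blast
    then show "\<forall>\<^sub>F N in sequentially. norm (\<Sum>n=1..N. a n * mult_ext z n) \<le> M + \<eta>"
    proof eventually_elim
      case (elim N)
      have "norm (\<Sum>n=1..N. (a n * of_nat n powr (- of_real \<epsilon>)) * mult_ext w n) \<le> M + \<eta>"
      proof (rule bohr_correspondence)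
        fix t :: real
        let ?s = "of_real \<epsilon> - \<i> * of_real t"
        have "norm (\<Sum>n=1..N. a n * of_nat n powr (- of_real \<epsilon>) * of_nat n powr (\<i> * of_real t))
            = norm (dirichlet_partial_sum a N ?s)"
          by (simp add: dirichlet_partial_sum_def mult.assoc powr_add[symmetric])
        also have "\<dots> \<le> norm (f ?s) + dist (dirichlet_partial_sum a N ?s) (f ?s)"
          by (metis dist_norm norm_triangle_sub)
        also have "\<dots> \<le> M + \<eta>"
          using elim M[of ?s] \<open>\<epsilon> > 0\<close> by (intro add_mono) (auto simp: less_imp_le)
        finally show "norm (\<Sum>n=1..N. a n * of_nat n powr (- of_real \<epsilon>) * of_nat n powr (\<i> * of_real t))
            \<le> M + \<eta>" .
      qed (use w1 in \<open>auto simp: less_imp_le\<close>)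
      moreover have "(\<Sum>n=1..N. (a n * of_nat n powr (- of_real \<epsilon>)) * mult_ext w n)
          = (\<Sum>n=1..N. a n * mult_ext z n)"
        by (intro sum.cong refl) (simp add: wz[symmetric] mult.assoc)
      ultimately show ?case by simp
    qed
  qed
  then show "(\<lambda>n. a n * mult_ext z n) summable_on {1..} \<and>
      norm (\<Sum>\<^sub>\<infinity>n\<in>{1..}. a n * mult_ext z n) \<le> M"
    using summ by (auto intro: field_le_epsilon)
qed

section \<open>Landau's bound for the truncation of a bounded power series\<close>

text \<open>
The Taylor coefficients of \<open>(1 - u) powr (-1/2)\<close>, also known as \<open>(2k choose k) / 4 ^ k\<close>. The binomial
series is used as the definition because Vandermonde's identity then gives their convolution.
\<close>

definition landau_coeff :: "nat \<Rightarrow> real" where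
  "landau_coeff k = (-1) ^ k * ((- 1 / 2) gchoose k)"

text \<open>
The square of \<open>(1 - u) powr (-1/2)\<close> is the geometric series.
\<close>

lemma landau_coeff_convolution: "(\<Sum>i\<le>m. landau_coeff i * landau_coeff (m - i)) = 1"
proof -
  have "(\<Sum>i\<le>m. landau_coeff i * landau_coeff (m - i))
      = (\<Sum>i\<le>m. (-1) ^ m * (((- 1 / 2) gchoose i) * ((- 1 / 2) gchoose (m - i))))"
  proof (intro sum.cong refl)
    fix i assume "i \<in> {..m}"
    then have "(-1::real) ^ i * (-1) ^ (m - i) = (-1) ^ m" by (simp flip: power_add)
    then show "landau_coeff i * landau_coeff (m - i)
        = (-1) ^ m * (((- 1 / 2) gchoose i) * ((- 1 / 2) gchoose (m - i)))"
      by (metis (no_types, opaque_lifting) landau_coeff_def mult.assoc mult.left_commute)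
  qed
  also have "\<dots> = (-1) ^ m * ((- 1 :: real) gchoose m)"
    using gbinomial_Vandermonde[of "- 1 / 2 :: real" "- 1 / 2" m]
    by (simp add: sum_distrib_left[symmetric] atMost_atLeast0)
  also have "\<dots> = 1"
    using gbinomial_minus[of "1::real" m] by (simp add: binomial_gbinomial[symmetric])
  finally show ?thesis .
qed

lemma landau_coeff_Suc:
  "landau_coeff (Suc k) = landau_coeff k * ((2 * real k + 1) / (2 * real k + 2))"
  by (simp add: landau_coeff_def gbinomial_mult_1 gbinomial_Suc_rec field_simps)

lemma landau_coeff_square_le: "landau_coeff k ^ 2 \<le> 1 / (2 * real k + 1)"
proof (induction k)
  case 0
  then show ?case by (simp add: landau_coeff_def)
next
  case (Suc k)
  define x where "x = 2 * real k + 1"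
  have "x > 0" by (simp add: x_def)
  have "landau_coeff (Suc k) = landau_coeff k * (x / (x + 1))"
    by (simp add: landau_coeff_Suc x_def add.commute)
  then have "landau_coeff (Suc k) ^ 2 = landau_coeff k ^ 2 * (x / (x + 1)) ^ 2"
    by (simp only: power_mult_distrib)
  also have "\<dots> \<le> 1 / x * (x / (x + 1)) ^ 2"
    using Suc.IH by (intro mult_right_mono) (auto simp: x_def)
  also have "\<dots> = x / (x + 1) ^ 2"
    using \<open>x > 0\<close> by (simp add: power2_eq_square)
  also have "\<dots> \<le> 1 / (x + 2)"
  proof -
    have "x * (x + 2) \<le> (x + 1) ^ 2" by (simp add: power2_eq_square algebra_simps)
    then show ?thesis using \<open>x > 0\<close> by (simp add: divide_simps)
  qed
  finally show ?case by (simp add: x_def add_ac)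
qed

lemma sum_landau_coeff_square_le: "(\<Sum>k\<le>K. landau_coeff k ^ 2) \<le> 1 + ln (real K + 1)"
proof (induction K)
  case 0
  then show ?case by (simp add: landau_coeff_def)
next
  case (Suc K)
  have "ln ((real K + 1) / (real K + 2)) \<le> (real K + 1) / (real K + 2) - 1"
    by (intro ln_le_minus_one) auto
  then have "ln (real K + 1) - ln (real K + 2) \<le> - (1 / (real K + 2))"
    by (simp add: ln_div field_simps)
  moreover have "1 / (2 * real (Suc K) + 1) \<le> 1 / (real K + 2)"
    by (intro divide_left_mono) auto
  ultimately show ?case
    using Suc landau_coeff_square_le[of "Suc K"] by (simp add: add.commute)
qed

lemma roots_of_unity_orthogonal:
  assumes "a < L" "b < L"
  shows "(\<Sum>j<L. cis (2 * pi * real j / real L) ^ a * cnj (cis (2 * pi * real j / real L)) ^ b)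
      = (if a = b then of_nat L else 0)"
proof -
  define w where "w = cis (2 * pi * (real a - real b) / real L)"
  have "L > 0" using assms by simp
  have pw: "cis (2 * pi * real j / real L) ^ a * cnj (cis (2 * pi * real j / real L)) ^ b = w ^ j" for j
  proof -
    have "cis (2 * pi * real j / real L) ^ a * cnj (cis (2 * pi * real j / real L)) ^ b
        = cis (real a * (2 * pi * real j / real L) + real b * - (2 * pi * real j / real L))"
      by (simp only: cis_cnj Complex.DeMoivre cis_mult)
    also have "real a * (2 * pi * real j / real L) + real b * - (2 * pi * real j / real L)
        = real j * (2 * pi * (real a - real b) / real L)"
      using \<open>L > 0\<close> by (simp add: field_simps)
    finally show ?thesis by (simp only: w_def Complex.DeMoivre)
  qed
  show ?thesis
  proof (cases "a = b")
    case True
    then have "w = 1" by (simp add: w_def)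
    then show ?thesis unfolding pw using True by simp
  next
    case False
    have "w \<noteq> 1"
    proof
      assume "w = 1"
      then obtain k :: int where eq: "2 * pi * (real a - real b) / real L = 2 * pi * of_int k"
        by (auto simp: w_def complex_eq_iff cos_one_2pi_int)
      have "(real a - real b) / real L = (2 * pi * (real a - real b) / real L) / (2 * pi)" by simp
      also have "\<dots> = of_int k" unfolding eq by simp
      finally have "(real a - real b) / real L = of_int k" .
      then have "real a - real b = of_int k * real L" using \<open>L > 0\<close> by (simp add: field_simps)
      then have "real_of_int (int a - int b) = real_of_int (k * int L)" by simp
      then have *: "int a - int b = k * int L" by (simp only: of_int_eq_iff)
      then have "int L dvd int a - int b" by simp
      then have "\<bar>int a - int b\<bar> \<ge> int L" using False by (intro dvd_imp_le_int[of "int a - int b" "int L", simplified]) auto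
      then show False using assms by linarith
    qed
    have "w ^ L = cis (2 * pi * of_int (int a - int b))"
      using \<open>L > 0\<close> by (simp add: w_def Complex.DeMoivre)
    then have "w ^ L = 1" using cis_multiple_2pi[of "of_int (int a - int b)"] by simp
    then show ?thesis unfolding pw using False \<open>w \<noteq> 1\<close> by (simp add: geometric_sum)
  qed
qed

text \<open>
Landau's argument for partial sums of bounded power series. Let \<open>Q\<close> be the Taylor polynomial
of degree \<open>K\<close> of \<open>(1 - u) powr (-1/2)\<close>. Since \<open>Q\<^sup>2\<close> agrees with the geometric series up to degree
\<open>K\<close>, the sum of the coefficients of \<open>f\<close> up to degree \<open>K\<close> is the coefficient of \<open>u ^ K\<close> in \<open>f * Q\<^sup>2\<close>, hence
the mean of \<open>f * Q\<^sup>2 * u ^ (-K)\<close> over the unit circle. It is at most the bound for \<open>f\<close> times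
the mean of \<open>\<bar>Q\<bar>\<^sup>2\<close>, which is the sum of the squares of the coefficients of \<open>Q\<close>. As
\<open>f\<close> is a polynomial here, the means may be taken over roots of unity of sufficiently high order.
The polynomial \<open>f\<close> is given as a sum over an index set \<open>F\<close> so that several terms may have the same degree.
\<close>

lemma landau_truncation:
  fixes g :: "'n \<Rightarrow> complex" and k :: "'n \<Rightarrow> nat"
  assumes "finite F" and B: "\<And>u. norm u = 1 \<Longrightarrow> norm (\<Sum>n\<in>F. g n * u ^ k n) \<le> B"
  shows "norm (\<Sum>n | n \<in> F \<and> k n \<le> K. g n) \<le> B * (1 + ln (real K + 1))"
proof -
  \<comment> \<open>The order \<open>L\<close> exceeds the degree of \<open>f * Q\<^sup>2\<close>, so no two distinct exponents are congruent modulo \<open>L\<close>.\<close>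
  define L where "L = Max (insert 0 (k ` F)) + 2 * K + 1"
  define U where "U j = cis (2 * pi * real j / real L)" for j
  define Q where "Q u = (\<Sum>i\<le>K. of_real (landau_coeff i) * u ^ i)" for u :: complex
  have "L > 0" by (simp add: L_def)
  have kL: "k n + 2 * K < L" if "n \<in> F" for n
    using that \<open>finite F\<close> by (auto simp: L_def intro!: Max_ge le_imp_less_Suc)
  have orth: "(\<Sum>j<L. U j ^ a * cnj (U j) ^ b) = (if a = b then of_nat L else 0)"
    if "a < L" "b < L" for a b
    unfolding U_def by (rule roots_of_unity_orthogonal[OF that])
  have [simp]: "norm (U j) = 1" for j by (simp add: U_def)
  have B0: "0 \<le> B" using order_trans[OF norm_ge_zero B[of 1]] by simp

  have parseval: "(\<Sum>j<L. norm (Q (U j)) ^ 2) = real L * (\<Sum>i\<le>K. landau_coeff i ^ 2)"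
  proof -
    have "complex_of_real (\<Sum>j<L. norm (Q (U j)) ^ 2) = (\<Sum>j<L. Q (U j) * cnj (Q (U j)))"
      by (simp only: of_real_sum complex_norm_square)
    also have "\<dots> = (\<Sum>j<L. \<Sum>i\<le>K. \<Sum>i'\<le>K. of_real (landau_coeff i * landau_coeff i') *
        (U j ^ i * cnj (U j) ^ i'))"
      by (simp add: Q_def sum_product mult_ac)
    also have "\<dots> = (\<Sum>i\<le>K. \<Sum>i'\<le>K. of_real (landau_coeff i * landau_coeff i') *
        (\<Sum>j<L. U j ^ i * cnj (U j) ^ i'))"
      unfolding sum_distrib_left
      by (subst sum.swap, rule sum.cong[OF refl], rule sum.swap)
    also have "\<dots> = (\<Sum>i\<le>K. \<Sum>i'\<le>K. of_real (landau_coeff i * landau_coeff i') *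
        (if i = i' then of_nat L else 0))"
      by (intro sum.cong refl arg_cong2[where f = "(*)"] orth) (auto simp: L_def)
    also have "\<dots> = of_real (real L * (\<Sum>i\<le>K. landau_coeff i ^ 2))"
      by (simp add: if_distrib[where f = "\<lambda>x. _ * x"] sum_distrib_left power2_eq_square mult_ac cong: if_cong)
    finally show ?thesis by (simp only: of_real_eq_iff)
  qed

  have coeff: "(\<Sum>i\<le>K. \<Sum>i'\<le>K. landau_coeff i * landau_coeff i' * (if m + i + i' = K then 1 else 0))
      = (if m \<le> K then 1 else 0)" for m
  proof (cases "m \<le> K")
    case True
    have "(\<Sum>i'\<le>K. landau_coeff i * landau_coeff i' * (if m + i + i' = K then 1 else 0))
        = (if i \<le> K - m then landau_coeff i * landau_coeff (K - m - i) else 0)" for i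
    proof (cases "i \<le> K - m")
      case True
      then have "m + i + i' = K \<longleftrightarrow> i' = K - m - i" for i' using \<open>m \<le> K\<close> by auto
      then show ?thesis using True
        by (simp add: if_distrib[where f = "\<lambda>x. _ * x"] cong: if_cong)
    qed (use \<open>m \<le> K\<close> in \<open>auto intro!: sum.neutral\<close>)
    then have "(\<Sum>i\<le>K. \<Sum>i'\<le>K. landau_coeff i * landau_coeff i' * (if m + i + i' = K then 1 else 0))
        = (\<Sum>i\<le>K. if i \<le> K - m then landau_coeff i * landau_coeff (K - m - i) else 0)"
      by simp
    also have "\<dots> = (\<Sum>i\<le>K - m. landau_coeff i * landau_coeff (K - m - i))"
      by (intro sum.mono_neutral_cong_right) auto
    finally show ?thesis using True landau_coeff_convolution[of "K - m"] by simp
  qed auto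

  have cutoff: "of_nat L * (\<Sum>n | n \<in> F \<and> k n \<le> K. g n)
      = (\<Sum>j<L. (\<Sum>n\<in>F. g n * U j ^ k n) * (cnj (U j) ^ K * Q (U j) ^ 2))"
  proof -
    have expand: "u ^ e * (cnj u ^ K * Q u ^ 2) = (\<Sum>i\<le>K. \<Sum>i'\<le>K.
        of_real (landau_coeff i * landau_coeff i') * (u ^ (e + i + i') * cnj u ^ K))" for u e
      by (simp add: Q_def power2_eq_square sum_product sum_distrib_left power_add mult_ac)
    have "(\<Sum>j<L. (\<Sum>n\<in>F. g n * U j ^ k n) * (cnj (U j) ^ K * Q (U j) ^ 2))
        = (\<Sum>j<L. \<Sum>n\<in>F. g n * (\<Sum>i\<le>K. \<Sum>i'\<le>K. of_real (landau_coeff i * landau_coeff i') *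
            (U j ^ (k n + i + i') * cnj (U j) ^ K)))"
      by (simp only: sum_distrib_right mult.assoc[of "g _"] expand)
    also have "\<dots> = (\<Sum>n\<in>F. g n * (\<Sum>i\<le>K. \<Sum>i'\<le>K. of_real (landau_coeff i * landau_coeff i') *
            (\<Sum>j<L. U j ^ (k n + i + i') * cnj (U j) ^ K)))"
      unfolding sum_distrib_left
      by (subst sum.swap, rule sum.cong[OF refl], subst sum.swap, rule sum.cong[OF refl], rule sum.swap)
    also have "\<dots> = (\<Sum>n\<in>F. g n * (\<Sum>i\<le>K. \<Sum>i'\<le>K. of_real (landau_coeff i * landau_coeff i') *
            (if k n + i + i' = K then of_nat L else 0)))"
    proof (intro sum.cong refl arg_cong2[where f = "(*)"] orth)
      fix n i i' assume "n \<in> F" "i \<in> {..K}" "i' \<in> {..K}"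
      then show "k n + i + i' < L" using kL[of n] by auto
    qed (auto simp: L_def)
    also have "\<dots> = (\<Sum>n\<in>F. g n * of_real (real L * (\<Sum>i\<le>K. \<Sum>i'\<le>K. landau_coeff i * landau_coeff i' *
            (if k n + i + i' = K then 1 else 0))))"
      unfolding sum_distrib_left of_real_sum
      by (intro sum.cong refl) auto
    also have "\<dots> = (\<Sum>n\<in>F. if k n \<le> K then of_nat L * g n else 0)"
      unfolding coeff by (intro sum.cong refl) auto
    also have "\<dots> = of_nat L * (\<Sum>n | n \<in> F \<and> k n \<le> K. g n)"
      using \<open>finite F\<close> by (simp add: sum.If_cases sum_distrib_left Collect_conj_eq)
    finally show ?thesis ..
  qed
  have "real L * norm (\<Sum>n | n \<in> F \<and> k n \<le> K. g n)
      = norm (of_nat L * (\<Sum>n | n \<in> F \<and> k n \<le> K. g n))"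
    by (simp only: norm_mult norm_of_nat)
  also have "\<dots> = norm (\<Sum>j<L. (\<Sum>n\<in>F. g n * U j ^ k n) * (cnj (U j) ^ K * Q (U j) ^ 2))"
    by (simp only: cutoff)
  also have "\<dots> \<le> (\<Sum>j<L. B * norm (Q (U j)) ^ 2)"
    by (intro sum_norm_le) (auto simp: norm_mult norm_power intro!: mult_right_mono B)
  also have "\<dots> = real L * (B * (\<Sum>i\<le>K. landau_coeff i ^ 2))"
    by (simp add: sum_distrib_left[symmetric] parseval)
  finally have "norm (\<Sum>n | n \<in> F \<and> k n \<le> K. g n) \<le> B * (\<Sum>i\<le>K. landau_coeff i ^ 2)"
    using \<open>L > 0\<close> by simp
  also have "\<dots> \<le> B * (1 + ln (real K + 1))"
    by (intro mult_left_mono sum_landau_coeff_square_le B0)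
  finally show ?thesis .
qed

section \<open>Partial sums of a Bohr bounded series\<close>

text \<open>
Rounding \<open>Q * ln p\<close> down at every prime factor of \<open>n\<close> loses at most the number of prime factors of
\<open>n\<close>, and that number is at most \<open>2 * ln n\<close> because \<open>2 * ln p \<ge> 1\<close>.
\<close>

lemma multiplicative_rounding:
  fixes Q :: real
  assumes "\<forall>p\<in>#A. prime p" and "Q \<ge> 0"
  defines "k \<equiv> \<lambda>p. nat \<lfloor>Q * ln (real p)\<rfloor>"
  shows "(Q - 2) * ln (real (\<Prod>p\<in>#A. p)) \<le> real (\<Sum>p\<in>#A. k p)"
    and "real (\<Sum>p\<in>#A. k p) \<le> Q * ln (real (\<Prod>p\<in>#A. p))"
proof -
  have "(Q - 2) * ln (real (\<Prod>p\<in>#A. p)) \<le> real (\<Sum>p\<in>#A. k p) \<and>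
      real (\<Sum>p\<in>#A. k p) \<le> Q * ln (real (\<Prod>p\<in>#A. p))"
    using assms(1)
  proof (induction A)
    case (add p A)
    then have "prime p" by simp
    then have p: "real p \<ge> 2" using prime_ge_2_nat[of p] by simp
    have "ln 2 \<le> ln (real p)" using p by simp
    then have "2 * ln (real p) \<ge> 1" using ln2_ge_two_thirds by simp
    moreover have "real (k p) \<le> Q * ln (real p)"
      unfolding k_def using p \<open>Q \<ge> 0\<close> by simp
    moreover have "Q * ln (real p) - 1 \<le> real (k p)"
      unfolding k_def by linarith
    moreover have "(\<Prod>p\<in>#A. p) \<noteq> 0"
      using add.prems by auto
    then have "ln (real (\<Prod>p\<in>#add_mset p A. p)) = ln (real p) + ln (real (\<Prod>p\<in>#A. p))"
      using p by (simp add: ln_mult)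
    ultimately show ?case using add by (simp add: algebra_simps)
  qed simp
  then show "(Q - 2) * ln (real (\<Prod>p\<in>#A. p)) \<le> real (\<Sum>p\<in>#A. k p)"
    and "real (\<Sum>p\<in>#A. k p) \<le> Q * ln (real (\<Prod>p\<in>#A. p))"
    by auto
qed

text \<open>
A single cut-off \<open>X\<close> works for all families that are dominated by \<open>g\<close>. It is applied to
\<open>h n = g n * u ^ k n\<close> with \<open>u\<close> on the unit circle.
\<close>

lemma summable_partial_sums_uniform:
  fixes g :: "nat \<Rightarrow> complex"
  assumes "(\<lambda>n. norm (g n)) summable_on {1..}" "\<eta> > 0"
  shows "\<exists>X\<ge>N. \<forall>h. (\<forall>n. norm (h n) \<le> norm (g n)) \<longrightarrow>
           norm (\<Sum>n=1..X. h n :: complex) \<le> norm (\<Sum>\<^sub>\<infinity>n\<in>{1..}. h n) + \<eta>"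
proof -
  define T where "T = (\<Sum>\<^sub>\<infinity>n\<in>{1..}. norm (g n))"
  have "(\<lambda>X. \<Sum>n=1..X. norm (g n)) \<longlonglongrightarrow> T"
    unfolding T_def using assms(1) by (intro has_sum_initial_segments has_sum_infsum)
  then have "\<forall>\<^sub>F X in sequentially. T - \<eta> < (\<Sum>n=1..X. norm (g n))"
    using \<open>\<eta> > 0\<close> by (intro order_tendstoD) auto
  then have "\<forall>\<^sub>F X in sequentially. N \<le> X \<and> T - \<eta> < (\<Sum>n=1..X. norm (g n))"
    by (intro eventually_conj eventually_ge_at_top)
  then obtain X where X: "N \<le> X" "T - \<eta> < (\<Sum>n=1..X. norm (g n))"
    using eventually_happens'[OF sequentially_bot] by blast
  have "norm (\<Sum>n=1..X. h n) \<le> norm (\<Sum>\<^sub>\<infinity>n\<in>{1..}. h n) + \<eta>"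
    if h: "\<forall>n. norm (h n) \<le> norm (g n)" for h :: "nat \<Rightarrow> complex"
  proof -
    have sg: "(\<lambda>n. norm (g n)) summable_on ({1..} - {1..X})"
      using assms(1) by (rule summable_on_subset_banach) auto
    then have sh: "(\<lambda>n. norm (h n)) summable_on ({1..} - {1..X})"
      by (rule summable_on_comparison_test) (use h in auto)
    have sh1: "h summable_on {1..}"
      by (rule abs_summable_summable, rule summable_on_comparison_test[OF assms(1)]) (use h in auto)
    have "norm (\<Sum>\<^sub>\<infinity>n\<in>{1..} - {1..X}. h n) \<le> (\<Sum>\<^sub>\<infinity>n\<in>{1..} - {1..X}. norm (h n))"
      using sh by (rule norm_infsum_bound)
    also have "\<dots> \<le> (\<Sum>\<^sub>\<infinity>n\<in>{1..} - {1..X}. norm (g n))"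
      using sh sg h by (intro infsum_mono) auto
    also have "\<dots> = T - (\<Sum>n=1..X. norm (g n))"
      unfolding T_def using assms(1) by (subst infsum_Diff) auto
    also have "\<dots> \<le> \<eta>" using X by simp
    finally have "norm ((\<Sum>\<^sub>\<infinity>n\<in>{1..}. h n) - (\<Sum>n=1..X. h n)) \<le> \<eta>"
      using sh1 by (subst (asm) infsum_Diff) auto
    then show ?thesis
      using norm_triangle_sub[of "\<Sum>n=1..X. h n" "\<Sum>\<^sub>\<infinity>n\<in>{1..}. h n"]
      by (simp add: norm_minus_commute)
  qed
  then show ?thesis using X(1) by blast
qed

text \<open>
The additive function \<open>kk\<close> with \<open>kk p = k p\<close> is so close to \<open>Q * ln\<close> that it
separates the integers up to \<open>N\<close> from the others: \<open>n \<le> N\<close> if and only if \<open>kk n \<le> K\<close>. As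
\<open>u ^ kk n\<close> is completely multiplicative in \<open>n\<close>, the series \<open>\<Sum> g n * u ^ kk n\<close> is bounded by \<open>M\<close> on the unit
circle, and the partial sum is its truncation at degree \<open>K\<close>. The coordinates \<open>z p\<close> with \<open>p > N\<close> are set to
\<open>0\<close>, which does not affect the first \<open>N\<close> terms.
\<close>

lemma dirichlet_partial_sum_bound:
  assumes a: "bohr_bounded a M" and s: "0 < Re s" and "N > 0"
  shows "norm (dirichlet_partial_sum a N s) \<le> M * (1 + ln (2 * (real N + 1) ^ 3 + 1))"
proof -
  \<comment> \<open>The gap \<open>Q * (ln (N + 1) - ln N) \<ge> Q / (N + 1)\<close> must exceed the rounding loss \<open>2 * ln (N + 1)\<close>.\<close>
  define Q :: real where "Q = 2 * (real N + 1) ^ 2"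
  define K where "K = nat \<lfloor>Q * ln (real N)\<rfloor>"
  define k where "k p = nat \<lfloor>Q * ln (real p)\<rfloor>" for p :: nat
  define kk where "kk n = (\<Sum>p\<in>#prime_factorization n. k p)" for n :: nat
  define z where "z p = (if p \<le> N then of_nat p powr (- s) else 0)" for p :: nat
  have M0: "0 \<le> M" using a by (rule bohr_bounded_nonneg)
  have "Q \<ge> 0" by (simp add: Q_def)
  have kk_le: "kk n \<le> K \<longleftrightarrow> n \<le> N" if "n > 0" for n
  proof -
    have rounding: "(Q - 2) * ln (real n) \<le> real (kk n)" "real (kk n) \<le> Q * ln (real n)"
      using multiplicative_rounding[of "prime_factorization n" Q] \<open>Q \<ge> 0\<close> that
      by (auto simp: kk_def k_def)
    show ?thesis
    proof (cases "n \<le> N")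
      case True
      then have "real (kk n) \<le> Q * ln (real N)"
        using rounding(2) \<open>Q \<ge> 0\<close> that by (meson dual_order.trans ln_mono mult_left_mono of_nat_0_less_iff of_nat_mono)
      then have "kk n \<le> K" unfolding K_def by linarith
      then show ?thesis using True by simp
    next
      case False
      have N: "real N > 0" using \<open>N > 0\<close> by simp
      have "ln (real N / (real N + 1)) \<le> real N / (real N + 1) - 1"
        using N by (intro ln_le_minus_one) auto
      then have "ln (real N + 1) - ln (real N) \<ge> 1 / (real N + 1)"
        using N by (simp add: ln_div field_simps)
      then have "Q * (ln (real N + 1) - ln (real N)) \<ge> Q * (1 / (real N + 1))"
        using \<open>Q \<ge> 0\<close> by (intro mult_left_mono)
      moreover have "Q * (1 / (real N + 1)) = 2 * (real N + 1)"
        using N by (simp add: Q_def power2_eq_square)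
      moreover have "ln (real N + 1) \<le> real N" using ln_le_minus_one[of "real N + 1"] N by simp
      ultimately have "Q * ln (real N) < (Q - 2) * ln (real N + 1)"
        by (simp add: algebra_simps)
      also have "\<dots> \<le> (Q - 2) * ln (real n)"
      proof (intro mult_left_mono)
        show "0 \<le> Q - 2" by (simp add: Q_def)
        show "ln (real N + 1) \<le> ln (real n)" using False N by simp
      qed
      also have "\<dots> \<le> real (kk n)" by (rule rounding)
      finally have "Q * ln (real N) < real (kk n)" .
      moreover have "real K \<le> Q * ln (real N)" unfolding K_def using \<open>Q \<ge> 0\<close> \<open>N > 0\<close> by simp
      ultimately have "K < kk n" by simp
      then show ?thesis using False by simp
    qed
  qed
  have zfin: "finite {p. prime p \<and> z p * u \<noteq> 0}" for u
    by (rule finite_subset[of _ "{..N}"]) (auto simp: z_def)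
  have z1: "norm (z p) < 1" if "prime p" for p
    using s prime_gt_1_nat[OF that] by (simp add: z_def norm_nat_powr powr_less_one)
  define g where "g n = a n * mult_ext z n" for n
  have gz: "g n = a n * of_nat n powr (- s)" if "n \<in> {1..N}" for n
  proof -
    have "mult_ext z n = mult_ext (\<lambda>p. of_nat p powr (- s)) n"
    proof (rule mult_ext_cong)
      fix p assume "p \<in> prime_factors n"
      then have "p \<le> N" using that by (auto simp: in_prime_factors_iff dest: dvd_imp_le)
      then show "z p = of_nat p powr (- s)" by (simp add: z_def)
    qed
    then show ?thesis using that by (simp add: g_def mult_ext_powr)
  qed
  have gu: "g n * u ^ kk n = a n * mult_ext (\<lambda>p. z p * u ^ k p) n" for n u
    by (simp add: g_def mult_ext_distrib kk_def power_sum_mset) (simp add: mult_ext_def)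
  have bound: "norm (\<Sum>\<^sub>\<infinity>n\<in>{1..}. g n * u ^ kk n) \<le> M" if "norm u = 1" for u
    unfolding gu
  proof (rule bohr_boundedD(2)[OF a])
    show "finite {p. prime p \<and> z p * u ^ k p \<noteq> 0}"
      using zfin[of 1] by (rule finite_subset[rotated]) auto
    show "norm (z p * u ^ k p) < 1" if "prime p" for p
      using z1[OF that] \<open>norm u = 1\<close> by (simp add: norm_mult norm_power)
  qed
  have "(\<lambda>n. g n) summable_on {1..}"
    unfolding g_def using zfin[of 1] z1 by (intro bohr_boundedD(1)[OF a]) auto
  then have gsum: "(\<lambda>n. norm (g n)) summable_on {1..}"
    by (simp add: summable_on_iff_abs_summable_on_complex)
  have approx: "norm (dirichlet_partial_sum a N s) \<le> (M + \<eta>) * (1 + ln (real K + 1))" if "\<eta> > 0" for \<eta>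
  proof -
    obtain X where X: "X \<ge> N" and *: "\<forall>h. (\<forall>n. norm (h n) \<le> norm (g n)) \<longrightarrow>
           norm (\<Sum>n=1..X. h n :: complex) \<le> norm (\<Sum>\<^sub>\<infinity>n\<in>{1..}. h n) + \<eta>"
      using summable_partial_sums_uniform[OF gsum \<open>\<eta> > 0\<close>, of N] by (elim exE conjE) (rule that)
    have "norm (\<Sum>n | n \<in> {1..X} \<and> kk n \<le> K. g n) \<le> (M + \<eta>) * (1 + ln (real K + 1))"
    proof (rule landau_truncation)
      fix u :: complex assume u: "norm u = 1"
      have "norm (\<Sum>n=1..X. g n * u ^ kk n) \<le> norm (\<Sum>\<^sub>\<infinity>n\<in>{1..}. g n * u ^ kk n) + \<eta>"
        by (rule *[rule_format]) (simp add: norm_mult norm_power u)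
      then show "norm (\<Sum>n=1..X. g n * u ^ kk n) \<le> M + \<eta>" using bound[OF u] by simp
    qed auto
    moreover have "{n. n \<in> {1..X} \<and> kk n \<le> K} = {1..N}" using X kk_le by auto
    moreover have "(\<Sum>n=1..N. g n) = dirichlet_partial_sum a N s"
      unfolding dirichlet_partial_sum_def by (intro sum.cong refl gz)
    ultimately show ?thesis by simp
  qed
  have "norm (dirichlet_partial_sum a N s) \<le> M * (1 + ln (real K + 1)) + e" if "e > 0" for e
  proof -
    have pos: "1 + ln (real K + 1) > 0" by (simp add: add_pos_nonneg)
    then have "e / (1 + ln (real K + 1)) > 0" using that by simp
    from approx[OF this] show ?thesis using pos by (simp add: distrib_right)
  qed
  then have "norm (dirichlet_partial_sum a N s) \<le> M * (1 + ln (real K + 1))"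
    by (rule field_le_epsilon)
  also have "\<dots> \<le> M * (1 + ln (2 * (real N + 1) ^ 3 + 1))"
  proof -
    have "real K \<le> Q * ln (real N)" unfolding K_def using \<open>Q \<ge> 0\<close> \<open>N > 0\<close> by simp
    also have "\<dots> \<le> Q * (real N + 1)"
      using ln_le_minus_one[of "real N"] \<open>N > 0\<close> \<open>Q \<ge> 0\<close> by (intro mult_left_mono) auto
    also have "\<dots> = 2 * (real N + 1) ^ 3"
      by (simp add: Q_def power2_eq_square power3_eq_cube mult.assoc)
    finally have "real K \<le> 2 * (real N + 1) ^ 3" .
    then show ?thesis using M0 by (intro mult_left_mono add_left_mono ln_mono) auto
  qed
  finally show ?thesis .
qed

section \<open>Convergence and boundedness of the limit function\<close>

lemma log_bound_le_powr:
  assumes "\<delta> > 0"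
  shows "\<exists>D. \<forall>N>0. 1 + ln (2 * (real N + 1) ^ 3 + 1) \<le> D * real N powr \<delta>"
proof (intro exI allI impI)
  fix N :: nat assume "N > 0"
  then have N: "real N \<ge> 1" by simp
  have "2 * (real N + 1) ^ 3 + 1 \<le> 2 * (2 * real N) ^ 3 + real N ^ 3"
    using N by (intro add_mono mult_left_mono power_mono) auto
  also have "\<dots> = 17 * real N ^ 3" by (simp add: power_mult_distrib)
  finally have "ln (2 * (real N + 1) ^ 3 + 1) \<le> ln (17 * real N ^ 3)"
    using N by (intro ln_mono) (auto intro: add_nonneg_pos)
  also have "\<dots> = ln 17 + 3 * ln (real N)" using N by (simp add: ln_mult ln_realpow)
  also have "\<dots> \<le> ln 17 + 3 * (real N powr \<delta> / \<delta>)"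
    using ln_powr_bound[OF N assms] by simp
  finally have "1 + ln (2 * (real N + 1) ^ 3 + 1) \<le> (1 + ln 17) * 1 + 3 / \<delta> * real N powr \<delta>" by simp
  also have "\<dots> \<le> (1 + ln 17) * real N powr \<delta> + 3 / \<delta> * real N powr \<delta>"
    using ge_one_powr_ge_zero[OF N] assms by (intro add_right_mono mult_left_mono) (auto simp: add_nonneg_nonneg)
  finally show "1 + ln (2 * (real N + 1) ^ 3 + 1) \<le> (1 + ln 17 + 3 / \<delta>) * real N powr \<delta>"
    by (simp add: distrib_right)
qed

text \<open>
Summation by parts with the weights \<open>x n ^ 2\<close>, for sums \<open>A n\<close> that are only \<open>O(1 / x n)\<close>. Squares are
convenient because \<open>x n ^ 2 - x (Suc n) ^ 2 \<le> 2 * x n * (x n - x (Suc n))\<close>: one factor \<open>x n\<close> absorbs the growth of \<open>A n\<close>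
and the remaining differences telescope.
\<close>

lemma abel_summation_tail:
  fixes A :: "nat \<Rightarrow> complex" and x :: "nat \<Rightarrow> real"
  assumes x: "\<And>n. N \<le> n \<Longrightarrow> 0 \<le> x (Suc n) \<and> x (Suc n) \<le> x n"
    and A: "\<And>n. N \<le> n \<Longrightarrow> norm (A n) * x n \<le> C" and "N \<le> m"
  shows "norm (\<Sum>n=Suc N..m. (A n - A (n - 1)) * of_real (x n ^ 2)) \<le> 4 * C * x N"
proof -
  have "(\<Sum>n=Suc N..m. (A n - A (n - 1)) * of_real (x n ^ 2))
      = A m * of_real (x m ^ 2) - A N * of_real (x N ^ 2)
        + (\<Sum>n=N..<m. A n * of_real (x n ^ 2 - x (Suc n) ^ 2))"
    using \<open>N \<le> m\<close> by (induction m rule: dec_induct) (auto simp: algebra_simps)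
  also have "norm \<dots> \<le> norm (A m * of_real (x m ^ 2)) + norm (A N * of_real (x N ^ 2))
        + (\<Sum>n=N..<m. norm (A n * of_real (x n ^ 2 - x (Suc n) ^ 2)))"
    by (intro norm_triangle_mono norm_triangle_le_diff norm_sum order_refl)
  also have "\<dots> \<le> C * x N + C * x N + (\<Sum>n=N..<m. 2 * C * (x n - x (Suc n)))"
  proof -
    have x0: "0 \<le> x n" if "N \<le> n" for n
      using x[OF that] by linarith
    have C0: "0 \<le> C" using A[of N] x0[of N] by (meson mult_nonneg_nonneg norm_ge_zero order_refl order_trans)
    have end_term: "norm (A n * of_real (x n ^ 2)) \<le> C * x n" if "N \<le> n" for n
    proof -
      have "norm (A n * of_real (x n ^ 2)) = norm (A n) * x n * x n"
        by (simp add: norm_mult norm_power power2_eq_square)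
      then show ?thesis using A[OF that] x0[OF that] by (simp add: mult_right_mono)
    qed
    have xm: "x m \<le> x N"
      using \<open>N \<le> m\<close> x by (induction m rule: dec_induct) (auto intro: order_trans)
    have "norm (A m * of_real (x m ^ 2)) \<le> C * x N"
      using end_term[OF \<open>N \<le> m\<close>] mult_left_mono[OF xm C0] by linarith
    moreover have "norm (A n * of_real (x n ^ 2 - x (Suc n) ^ 2)) \<le> 2 * C * (x n - x (Suc n))"
      if "N \<le> n" for n
    proof -
      have d: "0 \<le> x n - x (Suc n)" "x n + x (Suc n) \<le> 2 * x n" "0 \<le> x n + x (Suc n)"
        using x[OF that] by auto
      have "x n ^ 2 - x (Suc n) ^ 2 = (x n + x (Suc n)) * (x n - x (Suc n))"
        by (simp add: power2_eq_square algebra_simps)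
      then have "norm (A n * of_real (x n ^ 2 - x (Suc n) ^ 2))
          = norm (A n) * (x n + x (Suc n)) * (x n - x (Suc n))"
        using d by (simp add: norm_mult flip: of_real_diff of_real_add)
      also have "\<dots> \<le> norm (A n) * (2 * x n) * (x n - x (Suc n))"
        using d by (intro mult_right_mono mult_left_mono) auto
      also have "\<dots> = 2 * (norm (A n) * x n) * (x n - x (Suc n))" by simp
      also have "\<dots> \<le> 2 * C * (x n - x (Suc n))"
        using A[OF that] d by (intro mult_right_mono mult_left_mono) auto
      finally show ?thesis .
    qed
    ultimately show ?thesis
      using end_term[of N] by (intro add_mono sum_mono) auto
  qed
  also have "(\<Sum>n=N..<m. 2 * C * (x n - x (Suc n))) = 2 * C * (x N - x m)"
    using sum_Suc_diff'[OF \<open>N \<le> m\<close>, of "\<lambda>n. - x n"] by (simp add: sum_distrib_left[symmetric])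
  also have "C * x N + C * x N + 2 * C * (x N - x m) \<le> 4 * C * x N"
  proof -
    have "0 \<le> x m" using x[OF \<open>N \<le> m\<close>] by linarith
    moreover have "0 \<le> x N" using x[OF order_refl] by linarith
    then have "0 \<le> C" using A[of N] by (meson mult_nonneg_nonneg norm_ge_zero order_refl order_trans)
    ultimately have "0 \<le> C * x m" by simp
    then show ?thesis by (simp add: algebra_simps)
  qed
  finally show ?thesis by simp
qed

text \<open>
Essential here is that the rate depends on \<open>a\<close> through \<open>M\<close> only. The partial sums at
\<open>s - 2 * \<delta>\<close> are \<open>O(M * n powr \<delta>)\<close>, and the weights \<open>n powr (-2 * \<delta>)\<close> lead back to \<open>s\<close>.
\<close>

lemma dirichlet_tail_bound:
  assumes "\<delta> > 0"
  shows "\<exists>D. \<forall>a M s N m. bohr_bounded a M \<longrightarrow> 2 * \<delta> < Re s \<longrightarrow> 0 < N \<longrightarrow> N \<le> m \<longrightarrow>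
           norm (dirichlet_partial_sum a m s - dirichlet_partial_sum a N s) \<le> D * M * real N powr (- \<delta>)"
proof -
  obtain D where D: "\<forall>N>0. 1 + ln (2 * (real N + 1) ^ 3 + 1) \<le> D * real N powr \<delta>"
    using log_bound_le_powr[OF assms] by auto
  show ?thesis
  proof (intro exI allI impI)
    fix a M s and N m :: nat
    assume a: "bohr_bounded a M" and s: "2 * \<delta> < Re s" and N: "0 < N" "N \<le> m"
    define A where "A n = dirichlet_partial_sum a n (s - of_real (2 * \<delta>))" for n
    have M0: "0 \<le> M" using a by (rule bohr_bounded_nonneg)
    have A: "norm (A n) * real n powr (- \<delta>) \<le> D * M" if "N \<le> n" for n
    proof -
      have n: "n > 0" using that N by simp
      have "norm (A n) \<le> M * (1 + ln (2 * (real n + 1) ^ 3 + 1))"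
        unfolding A_def using a s n by (intro dirichlet_partial_sum_bound) auto
      also have "\<dots> \<le> M * (D * real n powr \<delta>)"
        using D n M0 by (intro mult_left_mono) auto
      finally have "norm (A n) * real n powr (- \<delta>) \<le> M * (D * real n powr \<delta>) * real n powr (- \<delta>)"
        by (rule mult_right_mono) auto
      also have "\<dots> = D * M" using n by (simp add: powr_minus)
      finally show ?thesis .
    qed
    have "dirichlet_partial_sum a m s - dirichlet_partial_sum a N s
        = (\<Sum>n=Suc N..m. a n * of_nat n powr (- s))"
      using N(2) by (induction m rule: dec_induct) (auto simp: dirichlet_partial_sum_def algebra_simps)
    also have "\<dots> = (\<Sum>n=Suc N..m. (A n - A (n - 1)) * of_real ((real n powr (- \<delta>)) ^ 2))"
    proof (intro sum.cong refl)
      fix n assume "n \<in> {Suc N..m}"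
      then obtain k where k: "n = Suc k" by (cases n) auto
      have "A n - A (n - 1) = a n * of_nat n powr (of_real (2 * \<delta>) - s)"
        by (simp add: A_def dirichlet_partial_sum_def k)
      moreover have "(real n powr (- \<delta>)) ^ 2 = real n powr (- (2 * \<delta>))"
        by (simp add: power2_eq_square powr_add[symmetric])
      moreover have "complex_of_real (real n powr (- (2 * \<delta>))) = of_nat n powr (- of_real (2 * \<delta>))"
        using powr_of_real[of "real n" "- (2 * \<delta>)"] by simp
      ultimately show "a n * of_nat n powr (- s) = (A n - A (n - 1)) * of_real ((real n powr (- \<delta>)) ^ 2)"
        by (simp add: mult.assoc powr_add[symmetric])
    qed
    also have "norm \<dots> \<le> 4 * (D * M) * real N powr (- \<delta>)"
    proof (rule abel_summation_tail)
      show "0 \<le> real (Suc n) powr - \<delta> \<and> real (Suc n) powr - \<delta> \<le> real n powr - \<delta>" if "N \<le> n" for n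
        using that N \<open>\<delta> > 0\<close> by (auto intro!: powr_mono2')
    qed (use A N in auto)
    finally show "norm (dirichlet_partial_sum a m s - dirichlet_partial_sum a N s)
        \<le> 4 * D * M * real N powr (- \<delta>)" by (simp add: mult.assoc)
  qed
qed

lemma dirichlet_tail_tendsto_0:
  assumes "\<delta> > 0" shows "(\<lambda>N. C * real N powr (- \<delta>)) \<longlonglongrightarrow> 0"
  using tendsto_mult[OF tendsto_const[of C] tendsto_neg_powr[OF _ filterlim_real_sequentially, of "- \<delta>"]] assms
  by simp

lemma dirichlet_converges_to_limit:
  "dirichlet_converges_to a f \<Longrightarrow> 0 < Re s \<Longrightarrow> (\<lambda>N. dirichlet_partial_sum a N s) \<longlonglongrightarrow> f s"
  unfolding dirichlet_converges_to_def
  by (rule tendsto_uniform_limitI[where S = "{w. Re s / 2 < Re w}"]) (auto dest: half_gt_zero)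

lemma dirichlet_limit_eq:
  "dirichlet_converges_to a f \<Longrightarrow> 0 < Re s \<Longrightarrow> dirichlet_limit a s = f s"
  unfolding dirichlet_limit_def by (intro limI dirichlet_converges_to_limit)

lemma bohr_bounded_imp_converges:
  assumes a: "bohr_bounded a M"
  shows "dirichlet_converges_to a (dirichlet_limit a)"
  unfolding dirichlet_converges_to_def
proof (intro allI impI)
  fix \<epsilon> :: real assume "\<epsilon> > 0"
  then have \<delta>: "\<epsilon> / 2 > 0" by simp
  obtain D where D: "\<forall>a M s N m. bohr_bounded a M \<longrightarrow> 2 * (\<epsilon> / 2) < Re s \<longrightarrow> 0 < N \<longrightarrow> N \<le> m \<longrightarrow>
      norm (dirichlet_partial_sum a m s - dirichlet_partial_sum a N s) \<le> D * M * real N powr (- (\<epsilon> / 2))"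
    using dirichlet_tail_bound[OF \<delta>] by (elim exE) (rule that)
  have "uniformly_Cauchy_on {s. \<epsilon> < Re s} (dirichlet_partial_sum a)"
  proof (rule uniformly_Cauchy_onI')
    fix e :: real assume "e > 0"
    have "\<forall>\<^sub>F N in sequentially. D * M * real N powr (- (\<epsilon> / 2)) < e"
      using dirichlet_tail_tendsto_0[OF \<delta>] \<open>e > 0\<close> by (rule order_tendstoD)
    then obtain N0 where N0: "\<And>N. N0 \<le> N \<Longrightarrow> D * M * real N powr (- (\<epsilon> / 2)) < e"
      by (auto simp: eventually_sequentially)
    have "dist (dirichlet_partial_sum a m s) (dirichlet_partial_sum a n s) < e"
      if "\<epsilon> < Re s" "Suc N0 \<le> m" "m < n" for s m n
    proof -
      have "norm (dirichlet_partial_sum a n s - dirichlet_partial_sum a m s) \<le> D * M * real m powr (- (\<epsilon> / 2))"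
        using that by (intro D[rule_format] a) auto
      also have "\<dots> < e" using that by (intro N0) auto
      finally show ?thesis by (simp add: dist_norm norm_minus_commute)
    qed
    then show "\<exists>N. \<forall>s\<in>{s. \<epsilon> < Re s}. \<forall>m\<ge>N. \<forall>n>m.
        dist (dirichlet_partial_sum a m s) (dirichlet_partial_sum a n s) < e"
      by (intro exI[of _ "Suc N0"]) auto
  qed
  then show "uniform_limit {s. \<epsilon> < Re s} (dirichlet_partial_sum a) (dirichlet_limit a) sequentially"
    unfolding dirichlet_limit_def
    using Cauchy_uniformly_convergent uniformly_convergent_uniform_limit_iff by blast
qed

text \<open>
Let \<open>b\<close> be the restriction of \<open>a\<close> to indices without prime factors above \<open>N\<close>. The \<open>N\<close>-th partial sums
of \<open>a\<close> and \<open>b\<close> coincide, the full series of \<open>b\<close> is a value of the power series in the polydisc and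
thus at most \<open>M\<close>, and the tail of \<open>b\<close> is small because \<open>b\<close> is Bohr bounded by the same
\<open>M\<close>.
\<close>

lemma bohr_bounded_imp_limit_le:
  assumes a: "bohr_bounded a M" and s: "0 < Re s"
  shows "norm (dirichlet_limit a s) \<le> M"
proof -
  define \<delta> where "\<delta> = Re s / 4"
  have "\<delta> > 0" using s by (simp add: \<delta>_def)
  obtain D where D: "\<forall>a M s N m. bohr_bounded a M \<longrightarrow> 2 * \<delta> < Re s \<longrightarrow> 0 < N \<longrightarrow> N \<le> m \<longrightarrow>
      norm (dirichlet_partial_sum a m s - dirichlet_partial_sum a N s) \<le> D * M * real N powr (- \<delta>)"
    using dirichlet_tail_bound[OF \<open>\<delta> > 0\<close>] by (elim exE) (rule that)
  have bound: "norm (dirichlet_partial_sum a N s) \<le> M + D * M * real N powr (- \<delta>)" if "N > 0" for N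
  proof -
    define v :: "nat \<Rightarrow> complex" where "v p = (if p \<le> N then 1 else 0)" for p
    define b where "b n = mult_ext v n * a n" for n
    define z where "z p = v p * of_nat p powr (- s)" for p
    have b: "bohr_bounded b M"
      unfolding b_def[abs_def] by (rule bohr_bounded_multiplier[OF a]) (simp add: v_def)
    have zfin: "finite {p. prime p \<and> z p \<noteq> 0}"
      by (rule finite_subset[of _ "{..N}"]) (auto simp: z_def v_def split: if_splits)
    have z1: "norm (z p) < 1" if "prime p" for p
      using s prime_gt_1_nat[OF that] by (simp add: z_def v_def norm_nat_powr norm_mult powr_less_one)
    have "(\<lambda>m. \<Sum>n=1..m. a n * mult_ext z n) \<longlonglongrightarrow> (\<Sum>\<^sub>\<infinity>n\<in>{1..}. a n * mult_ext z n)"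
      by (intro has_sum_initial_segments has_sum_infsum bohr_boundedD(1)[OF a zfin z1])
    moreover have "(\<Sum>n=1..m. a n * mult_ext z n) = dirichlet_partial_sum b m s" for m
      unfolding dirichlet_partial_sum_def
      by (intro sum.cong refl) (auto simp: z_def[abs_def] b_def mult_ext_distrib mult_ext_powr)
    ultimately have lim: "(\<lambda>m. dirichlet_partial_sum b m s) \<longlonglongrightarrow> (\<Sum>\<^sub>\<infinity>n\<in>{1..}. a n * mult_ext z n)"
      by simp
    have "(\<lambda>m. norm (dirichlet_partial_sum b m s) + D * M * real N powr (- \<delta>))
        \<longlonglongrightarrow> norm (\<Sum>\<^sub>\<infinity>n\<in>{1..}. a n * mult_ext z n) + D * M * real N powr (- \<delta>)"
      by (intro tendsto_intros lim)
    moreover have "\<forall>\<^sub>F m in sequentially. norm (dirichlet_partial_sum b N s)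
        \<le> norm (dirichlet_partial_sum b m s) + D * M * real N powr (- \<delta>)"
      using eventually_ge_at_top[of N]
    proof eventually_elim
      case (elim m)
      have "2 * \<delta> < Re s" using s by (simp add: \<delta>_def)
      then have "norm (dirichlet_partial_sum b m s - dirichlet_partial_sum b N s) \<le> D * M * real N powr (- \<delta>)"
        using elim that by (intro D[rule_format] b)
      then show ?case
        using norm_triangle_sub[of "dirichlet_partial_sum b N s" "dirichlet_partial_sum b m s"]
        by (simp add: norm_minus_commute)
    qed
    ultimately have "norm (dirichlet_partial_sum b N s)
        \<le> norm (\<Sum>\<^sub>\<infinity>n\<in>{1..}. a n * mult_ext z n) + D * M * real N powr (- \<delta>)"
      using tendsto_lowerbound by fastforce
    also have "\<dots> \<le> M + D * M * real N powr (- \<delta>)"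
      using bohr_boundedD(2)[OF a zfin z1] by simp
    also have "dirichlet_partial_sum b N s = dirichlet_partial_sum a N s"
      unfolding dirichlet_partial_sum_def
    proof (intro sum.cong refl)
      fix n assume n: "n \<in> {1..N}"
      have "mult_ext v n = mult_ext (\<lambda>_. 1) n"
      proof (rule mult_ext_cong)
        fix p assume "p \<in> prime_factors n"
        then have "p \<le> N" using n by (auto simp: in_prime_factors_iff dest: dvd_imp_le)
        then show "v p = 1" by (simp add: v_def)
      qed
      then show "b n * of_nat n powr - s = a n * of_nat n powr - s"
        by (simp add: b_def mult_ext_const)
    qed
    finally show ?thesis .
  qed
  have "(\<lambda>N. norm (dirichlet_partial_sum a N s)) \<longlonglongrightarrow> norm (dirichlet_limit a s)"
    by (intro tendsto_norm dirichlet_converges_to_limit bohr_bounded_imp_converges[OF a] s)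
  moreover have "(\<lambda>N. M + D * M * real N powr (- \<delta>)) \<longlonglongrightarrow> M + 0"
    by (intro tendsto_add tendsto_const dirichlet_tail_tendsto_0 \<open>\<delta> > 0\<close>)
  moreover have "\<forall>\<^sub>F N in sequentially. norm (dirichlet_partial_sum a N s) \<le> M + D * M * real N powr (- \<delta>)"
    using eventually_gt_at_top[of 0] by eventually_elim (rule bound)
  ultimately show ?thesis
    using tendsto_le[OF sequentially_bot] by fastforce
qed

section \<open>The four algebras in terms of coefficients\<close>

lemma dirichlet_converges_to_diff:
  assumes "dirichlet_converges_to a f" "dirichlet_converges_to b g"
  shows "dirichlet_converges_to (\<lambda>n. a n - b n) (\<lambda>s. f s - g s)"
proof -
  have "dirichlet_partial_sum (\<lambda>n. a n - b n) = (\<lambda>N s. dirichlet_partial_sum a N s - dirichlet_partial_sum b N s)"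
    by (simp add: dirichlet_partial_sum_def fun_eq_iff left_diff_distrib sum_subtractf)
  then show ?thesis
    using assms unfolding dirichlet_converges_to_def by (auto intro: uniform_limit_minus)
qed

text \<open>
The estimate for partial sums with \<open>M = 0\<close> says that all partial sums vanish.
\<close>

lemma bohr_bounded_0_imp_zero:
  assumes "bohr_bounded a 0" "n > 0"
  shows "a n = 0"
proof -
  have zero: "dirichlet_partial_sum a N 1 = 0" for N
  proof (cases "N = 0")
    case False
    then show ?thesis using dirichlet_partial_sum_bound[OF assms(1), of 1 N] by simp
  qed (simp add: dirichlet_partial_sum_def)
  obtain m where m: "n = Suc m" using assms(2) gr0_implies_Suc by blast
  have "a n * of_nat n powr (- 1) = dirichlet_partial_sum a n 1 - dirichlet_partial_sum a m 1"
    by (simp add: dirichlet_partial_sum_def m)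
  then have "a n * of_nat n powr (- 1) = 0" by (simp only: zero) simp
  then show ?thesis using assms(2) by (simp add: powr_def)
qed

lemma dirichlet_coefficients_unique:
  assumes "dirichlet_converges_to a f" "dirichlet_converges_to b f" "a 0 = b 0"
  shows "a = b"
proof
  fix n
  have "bohr_bounded (\<lambda>n. a n - b n) 0"
    by (rule bohr_bounded_of_limit[OF dirichlet_converges_to_diff[OF assms(1,2)]]) simp
  then show "a n = b n"
    using bohr_bounded_0_imp_zero[of "\<lambda>n. a n - b n" n] assms(3) by (cases "n = 0") auto
qed

lemma holomorphic_dirichlet_partial_sum: "dirichlet_partial_sum a N holomorphic_on S"
proof -
  have "(\<lambda>s. \<Sum>n=1..N. a n * of_nat n powr (- s)) holomorphic_on S"
    by (intro holomorphic_intros) auto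
  then show ?thesis by (simp add: dirichlet_partial_sum_def[abs_def])
qed

lemma dirichlet_converges_to_holomorphic:
  assumes "dirichlet_converges_to a f"
  shows "f holomorphic_on right_half_plane"
proof (rule holomorphic_uniform_sequence)
  show "open right_half_plane"
    unfolding right_half_plane_def by (rule open_halfspace_Re_gt)
  fix s assume "s \<in> right_half_plane"
  then have s: "0 < Re s" by (simp add: right_half_plane_def)
  have sub: "cball s (Re s / 2) \<subseteq> {w. Re s / 4 < Re w}"
  proof
    fix w assume "w \<in> cball s (Re s / 2)"
    then have "\<bar>Re (s - w)\<bar> \<le> Re s / 2"
      using abs_Re_le_cmod[of "s - w"] by (simp add: dist_norm)
    then have "Re s / 2 \<le> Re w" unfolding minus_complex.simps by linarith
    then show "w \<in> {w. Re s / 4 < Re w}" using s by simp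
  qed
  have "uniform_limit {w. Re s / 4 < Re w} (dirichlet_partial_sum a) f sequentially"
    using assms s unfolding dirichlet_converges_to_def by (simp del: divide_const_simps)
  then have "uniform_limit (cball s (Re s / 2)) (dirichlet_partial_sum a) f sequentially"
    using sub by (rule uniform_limit_on_subset)
  moreover have "cball s (Re s / 2) \<subseteq> right_half_plane"
    using sub s by (force simp: right_half_plane_def)
  ultimately show "\<exists>d>0. cball s d \<subseteq> right_half_plane \<and>
      uniform_limit (cball s d) (dirichlet_partial_sum a) f sequentially"
    using s by (intro exI[of _ "Re s / 2"]) auto
qed (rule holomorphic_dirichlet_partial_sum)

lemma O_u_I: "dirichlet_converges_to a f \<Longrightarrow> a 0 = 0 \<Longrightarrow> f \<in> O_u"
  by (auto simp: O_u_def formal_dirichlet_series_def intro: dirichlet_converges_to_holomorphic)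

definition dirichlet_shift :: "real \<Rightarrow> (nat \<Rightarrow> complex) \<Rightarrow> nat \<Rightarrow> complex" where
  "dirichlet_shift \<epsilon> a n = of_nat n powr (- of_real \<epsilon>) * a n"

lemma dirichlet_partial_sum_shift:
  "dirichlet_partial_sum (dirichlet_shift \<epsilon> a) N s = dirichlet_partial_sum a N (s + of_real \<epsilon>)"
  by (simp add: dirichlet_partial_sum_def dirichlet_shift_def mult_ac powr_add[symmetric])

text \<open>
A partial sum that is uniformly close to \<open>f\<close> shows that \<open>f\<close> is bounded on \<open>Re s > \<epsilon>\<close>.
\<close>

lemma converges_imp_bohr_bounded_shift:
  assumes conv: "dirichlet_converges_to a f" and "\<epsilon> > 0"
  shows "\<exists>M. bohr_bounded (dirichlet_shift \<epsilon> a) M"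
proof -
  have "uniform_limit {s. \<epsilon> < Re s} (dirichlet_partial_sum a) f sequentially"
    using assms by (simp add: dirichlet_converges_to_def)
  then have "\<forall>\<^sub>F N in sequentially. \<forall>s\<in>{s. \<epsilon> < Re s}. dist (dirichlet_partial_sum a N s) (f s) < 1"
    unfolding uniform_limit_iff by simp
  then obtain N where N: "\<forall>s\<in>{s. \<epsilon> < Re s}. dist (dirichlet_partial_sum a N s) (f s) < 1"
    using eventually_happens'[OF sequentially_bot] by blast
  define M where "M = (\<Sum>n=1..N. norm (a n)) + 1"
  have f_le: "norm (f s) \<le> M" if "\<epsilon> < Re s" for s
  proof -
    have "norm (dirichlet_partial_sum a N s) \<le> (\<Sum>n=1..N. norm (a n))"
      unfolding dirichlet_partial_sum_def
    proof (rule sum_norm_le)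
      fix n assume "n \<in> {1..N}"
      then have "real n powr (- Re s) \<le> 1"
        using that \<open>\<epsilon> > 0\<close> powr_mono[of "- Re s" 0 "real n"] by simp
      then show "norm (a n * of_nat n powr (- s)) \<le> norm (a n)"
        by (simp add: norm_mult norm_nat_powr mult_left_le)
    qed
    moreover have "norm (f s) \<le> norm (dirichlet_partial_sum a N s) + dist (dirichlet_partial_sum a N s) (f s)"
      using norm_triangle_sub[of "f s" "dirichlet_partial_sum a N s"] by (simp add: dist_norm norm_minus_commute)
    moreover have "dist (dirichlet_partial_sum a N s) (f s) < 1" using N that by simp
    ultimately show ?thesis by (simp add: M_def)
  qed
  have "dirichlet_converges_to (dirichlet_shift \<epsilon> a) (\<lambda>s. f (s + of_real \<epsilon>))"
    unfolding dirichlet_converges_to_def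
  proof (intro allI impI)
    fix e :: real assume "e > 0"
    then have "uniform_limit {s. e < Re s} (dirichlet_partial_sum a) f sequentially"
      using conv by (simp add: dirichlet_converges_to_def)
    then have "uniform_limit {s. e < Re s} (\<lambda>N s. dirichlet_partial_sum a N (s + of_real \<epsilon>))
        (\<lambda>s. f (s + of_real \<epsilon>)) sequentially"
      by (rule uniform_limit_compose') (use \<open>\<epsilon> > 0\<close> in auto)
    then show "uniform_limit {s. e < Re s} (dirichlet_partial_sum (dirichlet_shift \<epsilon> a))
        (\<lambda>s. f (s + of_real \<epsilon>)) sequentially"
      by (simp add: dirichlet_partial_sum_shift[abs_def])
  qed
  then have "bohr_bounded (dirichlet_shift \<epsilon> a) M"
    by (rule bohr_bounded_of_limit) (simp add: f_le)
  then show ?thesis ..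
qed

lemma bohr_bounded_shifts_imp_converges:
  assumes "\<And>\<epsilon>. \<epsilon> > 0 \<Longrightarrow> \<exists>M. bohr_bounded (dirichlet_shift \<epsilon> a) M"
  shows "dirichlet_converges_to a (dirichlet_limit a)"
  unfolding dirichlet_converges_to_def
proof (intro allI impI)
  fix \<epsilon> :: real assume "\<epsilon> > 0"
  define b where "b = dirichlet_shift (\<epsilon> / 2) a"
  obtain M where "bohr_bounded b M"
    using assms[of "\<epsilon> / 2"] \<open>\<epsilon> > 0\<close> by (auto simp: b_def)
  then have b: "dirichlet_converges_to b (dirichlet_limit b)"
    by (rule bohr_bounded_imp_converges)
  have shift_back: "dirichlet_partial_sum b N (s - of_real (\<epsilon> / 2)) = dirichlet_partial_sum a N s" for N s
    by (simp only: b_def dirichlet_partial_sum_shift diff_add_cancel)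
  have "uniform_limit {s. \<epsilon> / 2 < Re s} (dirichlet_partial_sum b) (dirichlet_limit b) sequentially"
    using b \<open>\<epsilon> > 0\<close> unfolding dirichlet_converges_to_def by (meson half_gt_zero)
  then have "uniform_limit {s. \<epsilon> < Re s} (\<lambda>N s. dirichlet_partial_sum b N (s - of_real (\<epsilon> / 2)))
      (\<lambda>s. dirichlet_limit b (s - of_real (\<epsilon> / 2))) sequentially"
    by (rule uniform_limit_compose') auto
  then show "uniform_limit {s. \<epsilon> < Re s} (dirichlet_partial_sum a) (dirichlet_limit a) sequentially"
    unfolding dirichlet_limit_def shift_back .
qed

lemma dirichlet_dilate_eq_mult_ext: "dirichlet_dilate r a n = mult_ext (\<lambda>_. of_real r) n * a n"
  by (simp add: dirichlet_dilate_def mult_ext_const)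

lemma dirichlet_series_of_H_infinity:
  "a \<in> dirichlet_series_of H_infinity \<longleftrightarrow> a 0 = 0 \<and> (\<exists>M. bohr_bounded a M)"
proof
  assume "a \<in> dirichlet_series_of H_infinity"
  then obtain f where "a 0 = 0" "dirichlet_converges_to a f" "bounded (f ` right_half_plane)"
    by (auto simp: dirichlet_series_of_def formal_dirichlet_series_def H_infinity_def)
  then show "a 0 = 0 \<and> (\<exists>M. bohr_bounded a M)"
    by (auto simp: bounded_iff right_half_plane_def intro: bohr_bounded_of_limit)
next
  assume "a 0 = 0 \<and> (\<exists>M. bohr_bounded a M)"
  then obtain M where "a 0 = 0" and a: "bohr_bounded a M" by auto
  have "dirichlet_limit a \<in> H_infinity"
    using bohr_bounded_imp_limit_le[OF a] O_u_I[OF bohr_bounded_imp_converges[OF a] \<open>a 0 = 0\<close>]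
    by (auto simp: H_infinity_def bounded_iff right_half_plane_def)
  then show "a \<in> dirichlet_series_of H_infinity"
    using bohr_bounded_imp_converges[OF a] \<open>a 0 = 0\<close>
    by (auto simp: dirichlet_series_of_def formal_dirichlet_series_def)
qed

text \<open>
If all dilates are Bohr bounded, then so are all shifts, because \<open>p powr (-\<epsilon>) \<le> 2 powr (-\<epsilon>)\<close> for every
prime: the shift by \<open>\<epsilon>\<close> is the dilate by \<open>r = 2 powr (-\<epsilon>)\<close> followed by a multiplier with
values in the unit disc. Shifts control uniform convergence. Conversely, convergence makes the
shifts Bohr bounded, hence also the shifts of a dilate, so the dilate converges and its bounded limit
function makes the dilate itself Bohr bounded.
\<close>

lemma dirichlet_series_of_O_b:
  "a \<in> dirichlet_series_of O_b \<longleftrightarrow>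
     a 0 = 0 \<and> (\<forall>r\<in>{0<..<1}. \<exists>M. bohr_bounded (dirichlet_dilate r a) M)"
proof
  assume "a \<in> dirichlet_series_of O_b"
  then obtain f where a0: "a 0 = 0" and a: "dirichlet_converges_to a f" and f: "f \<in> O_b"
    by (auto simp: dirichlet_series_of_def formal_dirichlet_series_def)
  obtain a' where a': "a' 0 = 0" "dirichlet_converges_to a' f"
    and bdd': "\<forall>r\<in>{0<..<1}. bounded (dirichlet_limit (dirichlet_dilate r a') ` right_half_plane)"
    using f by (auto simp: O_b_def formal_dirichlet_series_def)
  have "a' = a" using a a' a0 by (intro dirichlet_coefficients_unique) auto
  have "\<exists>M. bohr_bounded (dirichlet_dilate r a) M" if r: "r \<in> {0<..<1}" for r
  proof -
    have "\<exists>M. bohr_bounded (dirichlet_shift \<epsilon> (dirichlet_dilate r a)) M" if "\<epsilon> > 0" for \<epsilon>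
    proof -
      obtain M where M: "bohr_bounded (dirichlet_shift \<epsilon> a) M"
        using converges_imp_bohr_bounded_shift[OF a \<open>\<epsilon> > 0\<close>] by blast
      have "bohr_bounded (\<lambda>n. mult_ext (\<lambda>_. of_real r) n * dirichlet_shift \<epsilon> a n) M"
        using r by (intro bohr_bounded_multiplier[OF M]) auto
      then have "bohr_bounded (dirichlet_shift \<epsilon> (dirichlet_dilate r a)) M"
        by (rule bohr_bounded_cong) (simp add: dirichlet_shift_def dirichlet_dilate_eq_mult_ext)
      then show ?thesis ..
    qed
    then have conv: "dirichlet_converges_to (dirichlet_dilate r a) (dirichlet_limit (dirichlet_dilate r a))"
      by (rule bohr_bounded_shifts_imp_converges)
    have "bounded (dirichlet_limit (dirichlet_dilate r a) ` right_half_plane)"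
      using bdd' r unfolding \<open>a' = a\<close> by blast
    then obtain M where "\<forall>s\<in>right_half_plane. norm (dirichlet_limit (dirichlet_dilate r a) s) \<le> M"
      by (auto simp: bounded_iff)
    then have "bohr_bounded (dirichlet_dilate r a) M"
      by (intro bohr_bounded_of_limit[OF conv]) (auto simp: right_half_plane_def)
    then show ?thesis ..
  qed
  with a0 show "a 0 = 0 \<and> (\<forall>r\<in>{0<..<1}. \<exists>M. bohr_bounded (dirichlet_dilate r a) M)" by blast
next
  assume asm: "a 0 = 0 \<and> (\<forall>r\<in>{0<..<1}. \<exists>M. bohr_bounded (dirichlet_dilate r a) M)"
  have "\<exists>M. bohr_bounded (dirichlet_shift \<epsilon> a) M" if "\<epsilon> > 0" for \<epsilon>
  proof -
    define r where "r = 2 powr (- \<epsilon>)"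
    have r: "r > 0" "r < 1" using that by (auto simp: r_def powr_less_one)
    then have "r \<in> {0<..<1}" by simp
    then obtain M where M: "bohr_bounded (dirichlet_dilate r a) M" using asm by blast
    define w :: "nat \<Rightarrow> complex" where "w p = of_nat p powr (- of_real \<epsilon>) * of_real (1 / r)" for p
    have w: "norm (w p) \<le> 1" if "prime p" for p
    proof -
      have "real p powr (- \<epsilon>) \<le> 2 powr (- \<epsilon>)"
        using prime_ge_2_nat[OF \<open>prime p\<close>] \<open>\<epsilon> > 0\<close> by (intro powr_mono2') auto
      then show ?thesis using r by (simp add: w_def norm_mult norm_nat_powr norm_divide r_def[symmetric])
    qed
    have "bohr_bounded (\<lambda>n. mult_ext w n * dirichlet_dilate r a n) M"
      by (rule bohr_bounded_multiplier[OF M w])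
    then have "bohr_bounded (dirichlet_shift \<epsilon> a) M"
    proof (rule bohr_bounded_cong)
      fix n :: nat assume "n > 0"
      have "mult_ext w n * mult_ext (\<lambda>_. of_real r) n = of_nat n powr (- of_real \<epsilon>)"
        using \<open>n > 0\<close> r unfolding mult_ext_distrib[symmetric] by (simp add: w_def mult_ext_powr)
      then show "mult_ext w n * dirichlet_dilate r a n = dirichlet_shift \<epsilon> a n"
        by (simp add: dirichlet_dilate_eq_mult_ext dirichlet_shift_def mult.assoc[symmetric])
    qed
    then show ?thesis ..
  qed
  then have conv: "dirichlet_converges_to a (dirichlet_limit a)"
    by (rule bohr_bounded_shifts_imp_converges)
  have "bounded (dirichlet_limit (dirichlet_dilate r a) ` right_half_plane)" if "r \<in> {0<..<1}" for r
  proof -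
    obtain M where "bohr_bounded (dirichlet_dilate r a) M" using asm \<open>r \<in> {0<..<1}\<close> by blast
    then show ?thesis
      using bohr_bounded_imp_limit_le by (auto simp: bounded_iff right_half_plane_def intro!: exI[of _ M])
  qed
  then have "dirichlet_limit a \<in> O_b"
    using conv asm O_u_I[OF conv] unfolding O_b_def formal_dirichlet_series_def by blast
  then show "a \<in> dirichlet_series_of O_b"
    using conv asm unfolding dirichlet_series_of_def formal_dirichlet_series_def by blast
qed

lemma dirichlet_series_of_W:
  "a \<in> dirichlet_series_of dirichlet_W \<longleftrightarrow> a 0 = 0 \<and> summable (\<lambda>n. norm (a n))"
proof
  assume "a \<in> dirichlet_series_of dirichlet_W"
  then obtain f a' where "a 0 = 0" "dirichlet_converges_to a f"
    "a' 0 = 0" "dirichlet_converges_to a' f" "summable (\<lambda>n. norm (a' n))"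
    by (auto simp: dirichlet_series_of_def formal_dirichlet_series_def dirichlet_W_def)
  moreover from this have "a = a'" by (intro dirichlet_coefficients_unique) auto
  ultimately show "a 0 = 0 \<and> summable (\<lambda>n. norm (a n))" by simp
next
  assume a: "a 0 = 0 \<and> summable (\<lambda>n. norm (a n))"
  then have "dirichlet_converges_to a (dirichlet_limit a)"
    by (intro bohr_bounded_imp_converges[OF bohr_bounded_summable]) simp
  with a show "a \<in> dirichlet_series_of dirichlet_W"
    by (auto simp: dirichlet_series_of_def formal_dirichlet_series_def dirichlet_W_def intro: O_u_I)
qed

lemma dirichlet_W_bounded:
  assumes "g \<in> dirichlet_W"
  obtains c where "c 0 = 0" "summable (\<lambda>n. norm (c n))" "dirichlet_converges_to c g"
    "bounded (g ` right_half_plane)"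
proof -
  obtain c where c: "c 0 = 0" "summable (\<lambda>n. norm (c n))" "dirichlet_converges_to c g"
    using assms by (auto simp: dirichlet_W_def formal_dirichlet_series_def)
  have "norm (g s) \<le> (\<Sum>n. norm (c n))" if "0 < Re s" for s
    using bohr_bounded_imp_limit_le[OF bohr_bounded_summable[OF c(2)] that] dirichlet_limit_eq[OF c(3) that]
    by simp
  then have "bounded (g ` right_half_plane)"
    by (auto simp: bounded_iff right_half_plane_def)
  with c show ?thesis by (rule that)
qed

text \<open>
The supremum norm of \<open>f - g\<close> is at most \<open>\<epsilon>\<close> exactly if the difference of the coefficients is Bohr bounded
by \<open>\<epsilon>\<close>.
\<close>

lemma dirichlet_series_of_A:
  "a \<in> dirichlet_series_of dirichlet_A \<longleftrightarrow>
     a 0 = 0 \<and> (\<forall>\<epsilon>>0. \<exists>c. c 0 = 0 \<and> summable (\<lambda>n. norm (c n)) \<and> bohr_bounded (\<lambda>n. a n - c n) \<epsilon>)"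
proof
  assume "a \<in> dirichlet_series_of dirichlet_A"
  then obtain f where a0: "a 0 = 0" and a: "dirichlet_converges_to a f" and f: "f \<in> dirichlet_A"
    by (auto simp: dirichlet_series_of_def formal_dirichlet_series_def)
  have "\<exists>c. c 0 = 0 \<and> summable (\<lambda>n. norm (c n)) \<and> bohr_bounded (\<lambda>n. a n - c n) \<epsilon>" if "\<epsilon> > 0" for \<epsilon>
  proof -
    obtain g where g: "g \<in> dirichlet_W" "H_infinity_norm (\<lambda>s. f s - g s) < \<epsilon>"
      using f \<open>\<epsilon> > 0\<close> by (auto simp: dirichlet_A_def)
    obtain c where c: "c 0 = 0" "summable (\<lambda>n. norm (c n))" "dirichlet_converges_to c g"
      and gb: "bounded (g ` right_half_plane)"
      using g(1) by (rule dirichlet_W_bounded)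
    have fb: "bounded (f ` right_half_plane)" using f by (simp add: dirichlet_A_def H_infinity_def)
    obtain B where B: "\<forall>s\<in>right_half_plane. norm (f s) \<le> B" using fb by (auto simp: bounded_iff)
    obtain B' where B': "\<forall>s\<in>right_half_plane. norm (g s) \<le> B'" using gb by (auto simp: bounded_iff)
    have bdd: "bdd_above ((\<lambda>s. norm (f s - g s)) ` right_half_plane)"
      using B B' by (intro bdd_aboveI2[of _ _ "B + B'"] norm_triangle_le_diff add_mono) auto
    have "bohr_bounded (\<lambda>n. a n - c n) \<epsilon>"
    proof (rule bohr_bounded_of_limit[OF dirichlet_converges_to_diff[OF a c(3)]])
      fix s :: complex assume "0 < Re s"
      then have "norm (f s - g s) \<le> H_infinity_norm (\<lambda>s. f s - g s)"
        unfolding H_infinity_norm_def by (intro cSUP_upper bdd) (simp add: right_half_plane_def)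
      then show "norm (f s - g s) \<le> \<epsilon>" using g(2) by simp
    qed
    with c show ?thesis by blast
  qed
  with a0 show "a 0 = 0 \<and> (\<forall>\<epsilon>>0. \<exists>c. c 0 = 0 \<and> summable (\<lambda>n. norm (c n)) \<and> bohr_bounded (\<lambda>n. a n - c n) \<epsilon>)"
    by blast
next
  assume asm: "a 0 = 0 \<and> (\<forall>\<epsilon>>0. \<exists>c. c 0 = 0 \<and> summable (\<lambda>n. norm (c n)) \<and> bohr_bounded (\<lambda>n. a n - c n) \<epsilon>)"
  then obtain c where c: "summable (\<lambda>n. norm (c n))" "bohr_bounded (\<lambda>n. a n - c n) 1"
    using zero_less_one by blast
  have a: "bohr_bounded a (1 + (\<Sum>n. norm (c n)))"
    using bohr_bounded_add[OF c(2) bohr_bounded_summable[OF c(1)]] by simp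
  note conv = bohr_bounded_imp_converges[OF a]
  have "dirichlet_limit a \<in> H_infinity"
    using bohr_bounded_imp_limit_le[OF a] O_u_I[OF conv] asm
    by (auto simp: H_infinity_def bounded_iff right_half_plane_def)
  moreover have "\<exists>g\<in>dirichlet_W. H_infinity_norm (\<lambda>s. dirichlet_limit a s - g s) < \<epsilon>" if "\<epsilon> > 0" for \<epsilon>
  proof -
    have "\<epsilon> / 2 > 0" using that by simp
    then obtain c where c: "c 0 = 0" "summable (\<lambda>n. norm (c n))" "bohr_bounded (\<lambda>n. a n - c n) (\<epsilon> / 2)"
      using asm by blast
    have convc: "dirichlet_converges_to c (dirichlet_limit c)"
      by (rule bohr_bounded_imp_converges[OF bohr_bounded_summable[OF c(2)]])
    have "dirichlet_limit c \<in> dirichlet_W"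
      using c convc by (auto simp: dirichlet_W_def formal_dirichlet_series_def intro: O_u_I)
    moreover have "H_infinity_norm (\<lambda>s. dirichlet_limit a s - dirichlet_limit c s) \<le> \<epsilon> / 2"
      unfolding H_infinity_norm_def
    proof (rule cSUP_least)
      have "1 \<in> right_half_plane" by (simp add: right_half_plane_def)
      then show "right_half_plane \<noteq> {}" by blast
      fix s assume "s \<in> right_half_plane"
      then have s: "0 < Re s" by (simp add: right_half_plane_def)
      show "norm (dirichlet_limit a s - dirichlet_limit c s) \<le> \<epsilon> / 2"
        using bohr_bounded_imp_limit_le[OF c(3) s]
          dirichlet_limit_eq[OF dirichlet_converges_to_diff[OF conv convc] s] by simp
    qed
    ultimately show ?thesis using that by (intro bexI[of _ "dirichlet_limit c"]) auto
  qed
  ultimately show "a \<in> dirichlet_series_of dirichlet_A"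
    using asm conv by (auto simp: dirichlet_series_of_def formal_dirichlet_series_def dirichlet_A_def)
qed

section \<open>The action of permutations\<close>

lemma prime_factorization_mult_ext:
  fixes \<pi> :: "nat \<Rightarrow> nat"
  assumes "\<And>p. prime p \<Longrightarrow> prime (\<pi> p)"
  shows "prime_factorization (mult_ext \<pi> n) = image_mset \<pi> (prime_factorization n)"
  unfolding mult_ext_def using assms by (intro prime_factorization_prod_mset_primes) auto

lemma mult_ext_mult_ext:
  fixes \<pi> :: "nat \<Rightarrow> nat"
  assumes "\<And>p. prime p \<Longrightarrow> prime (\<pi> p)"
  shows "mult_ext z (mult_ext \<pi> n) = mult_ext (\<lambda>p. z (\<pi> p)) n"
proof -
  have "mult_ext z (mult_ext \<pi> n) = (\<Prod>p\<in>#image_mset \<pi> (prime_factorization n). z p)"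
    by (simp only: mult_ext_def[of z] prime_factorization_mult_ext[of \<pi>, OF assms])
  also have "\<dots> = mult_ext (\<lambda>p. z (\<pi> p)) n"
    by (simp add: mult_ext_def image_mset.compositionality o_def)
  finally show ?thesis .
qed

lemma mult_ext_id: "n > 0 \<Longrightarrow> mult_ext (\<lambda>p. p) n = n"
  by (simp add: mult_ext_def)

lemma bij_betw_mult_ext:
  fixes \<pi> :: "nat \<Rightarrow> nat"
  assumes "bij_betw \<pi> {p. prime p} {p. prime p}"
  shows "bij_betw (mult_ext \<pi>) {1..} {1..}"
proof -
  define \<rho> where "\<rho> = inv_into {p. prime p} \<pi>"
  have \<pi>: "prime (\<pi> p)" if "prime p" for p
    using assms that by (auto simp: bij_betw_def)
  have \<rho>: "prime (\<rho> p)" if "prime p" for p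
    using bij_betw_inv_into[OF assms] that by (auto simp: bij_betw_def \<rho>_def)
  have pos: "mult_ext \<tau> n \<in> {1..}" if "\<And>p. prime p \<Longrightarrow> prime (\<tau> p)" for \<tau> :: "nat \<Rightarrow> nat" and n
  proof -
    have "0 \<notin># image_mset \<tau> (prime_factorization n)"
    proof
      assume "0 \<in># image_mset \<tau> (prime_factorization n)"
      then obtain p where "p \<in># prime_factorization n" "\<tau> p = 0" by auto
      then show False using that[of p] by auto
    qed
    then have "mult_ext \<tau> n \<noteq> 0" by (simp add: mult_ext_def)
    then show ?thesis by simp
  qed
  show ?thesis
  proof (rule bij_betw_byWitness[where f' = "mult_ext \<rho>"])
    show "\<forall>n\<in>{1..}. mult_ext \<rho> (mult_ext \<pi> n) = n"
    proof
      fix n :: nat assume n: "n \<in> {1..}"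
      have "mult_ext \<rho> (mult_ext \<pi> n) = mult_ext (\<lambda>p. \<rho> (\<pi> p)) n"
        by (simp add: mult_ext_mult_ext \<pi>)
      also have "\<dots> = mult_ext (\<lambda>p. p) n"
        unfolding \<rho>_def by (intro mult_ext_cong bij_betw_inv_into_left[OF assms]) auto
      finally show "mult_ext \<rho> (mult_ext \<pi> n) = n" using n by (simp add: mult_ext_id)
    qed
    show "\<forall>n\<in>{1..}. mult_ext \<pi> (mult_ext \<rho> n) = n"
    proof
      fix n :: nat assume n: "n \<in> {1..}"
      have "mult_ext \<pi> (mult_ext \<rho> n) = mult_ext (\<lambda>p. \<pi> (\<rho> p)) n"
        by (simp add: mult_ext_mult_ext \<rho>)
      also have "\<dots> = mult_ext (\<lambda>p. p) n"
        unfolding \<rho>_def by (intro mult_ext_cong bij_betw_inv_into_right[OF assms]) auto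
      finally show "mult_ext \<pi> (mult_ext \<rho> n) = n" using n by (simp add: mult_ext_id)
    qed
    show "mult_ext \<pi> ` {1..} \<subseteq> {1..}" using pos[of \<pi>, OF \<pi>] by blast
    show "mult_ext \<rho> ` {1..} \<subseteq> {1..}" using pos[of \<rho>, OF \<rho>] by blast
  qed
qed

lemma bij_betw_nth_prime: "bij_betw nth_prime {1..} {p. prime p}"
proof -
  have "bij_betw (\<lambda>i. i - 1) {1..} (UNIV :: nat set)"
    by (rule bij_betw_byWitness[where f' = Suc]) auto
  moreover have "bij_betw (enumerate {p::nat. prime p}) UNIV {p. prime p}"
    by (intro bij_enumerate primes_infinite)
  ultimately have "bij_betw (enumerate {p::nat. prime p} \<circ> (\<lambda>i. i - 1)) {1..} {p. prime p}"
    by (rule bij_betw_trans)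
  then show ?thesis by (simp add: nth_prime_def[abs_def] o_def)
qed

text \<open>
The permutation of indices is transported to a permutation \<open>\<pi>\<close> of the primes themselves. The relabelling of
prime factors is the completely multiplicative extension of \<open>\<pi>\<close>.
\<close>

lemma prime_permutation_eq_mult_ext:
  assumes "\<sigma> permutes {1..}"
  obtains \<pi> where "bij_betw \<pi> {p. prime p} {p. prime p}"
    and "\<And>n. n > 0 \<Longrightarrow> prime_permutation \<sigma> n = mult_ext \<pi> n"
proof
  define idx where "idx = inv_into {1..} nth_prime"
  define \<pi> where "\<pi> p = nth_prime (\<sigma> (idx p))" for p
  note np = bij_betw_nth_prime
  have idx: "bij_betw idx {p. prime p} {1..}"
    unfolding idx_def by (rule bij_betw_inv_into[OF np])
  have "bij_betw (nth_prime \<circ> (\<sigma> \<circ> idx)) {p. prime p} {p. prime p}"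
    using idx permutes_imp_bij[OF assms] np by (intro bij_betw_trans)
  then show "bij_betw \<pi> {p. prime p} {p. prime p}"
    by (simp add: \<pi>_def[abs_def] o_def)
  fix n :: nat assume n: "n > 0"
  have idx_np: "idx (nth_prime i) = i" if "1 \<le> i" for i
    using bij_betw_inv_into_left[OF np] that by (simp add: idx_def)
  have "bij_betw nth_prime {i. 1 \<le> i \<and> nth_prime i dvd n} (prime_factors n)"
  proof (rule bij_betw_subset[OF np])
    show "nth_prime ` {i. 1 \<le> i \<and> nth_prime i dvd n} = prime_factors n"
    proof (intro equalityI subsetI)
      fix p assume "p \<in> nth_prime ` {i. 1 \<le> i \<and> nth_prime i dvd n}"
      then show "p \<in> prime_factors n"
        using np n by (auto simp: in_prime_factors_iff bij_betw_def)
    next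
      fix p assume "p \<in> prime_factors n"
      then have p: "prime p" "p dvd n" by (auto simp: in_prime_factors_iff)
      then have "p \<in> nth_prime ` {1..}" using np by (simp add: bij_betw_def)
      then show "p \<in> nth_prime ` {i. 1 \<le> i \<and> nth_prime i dvd n}" using p by auto
    qed
  qed auto
  then have "(\<Prod>p\<in>prime_factors n. \<pi> p ^ multiplicity p n)
      = (\<Prod>i | 1 \<le> i \<and> nth_prime i dvd n. \<pi> (nth_prime i) ^ multiplicity (nth_prime i) n)"
    by (rule prod.reindex_bij_betw[symmetric])
  also have "\<dots> = prime_permutation \<sigma> n"
    unfolding prime_permutation_def by (intro prod.cong refl) (auto simp: \<pi>_def idx_np)
  also have "(\<Prod>p\<in>prime_factors n. \<pi> p ^ multiplicity p n) = mult_ext \<pi> n"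
    unfolding mult_ext_def image_prod_mset_multiplicity
    by (intro prod.cong refl) (auto simp: count_prime_factorization)
  finally show "prime_permutation \<sigma> n = mult_ext \<pi> n" by simp
qed

lemma dirichlet_action_relabels:
  assumes "\<sigma> permutes {1..}"
  obtains \<pi> where "bij_betw \<pi> {p. prime p} {p. prime p}"
    and "\<And>a n. n > 0 \<Longrightarrow> dirichlet_action \<sigma> a (mult_ext \<pi> n) = a n"
proof -
  obtain \<pi> where \<pi>: "bij_betw \<pi> {p. prime p} {p. prime p}"
    and eq: "\<And>n. n > 0 \<Longrightarrow> prime_permutation \<sigma> n = mult_ext \<pi> n"
    using prime_permutation_eq_mult_ext[OF assms] by blast
  have "bij_betw (prime_permutation \<sigma>) {1..} {1..} \<longleftrightarrow> bij_betw (mult_ext \<pi>) {1..} {1..}"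
    by (intro bij_betw_cong) (simp add: eq)
  then have bij: "bij_betw (prime_permutation \<sigma>) {1..} {1..}"
    using bij_betw_mult_ext[OF \<pi>] by simp
  have "dirichlet_action \<sigma> a (mult_ext \<pi> n) = a n" if "n > 0" for a n
  proof -
    have "mult_ext \<pi> n \<in> {1..}" using bij_betw_mult_ext[OF \<pi>] that by (auto simp: bij_betw_def)
    moreover have "inv_into {1..} (prime_permutation \<sigma>) (prime_permutation \<sigma> n) = n"
      using bij that by (intro bij_betw_inv_into_left) auto
    ultimately show ?thesis using that by (simp add: dirichlet_action_def eq)
  qed
  with \<pi> show ?thesis by (rule that)
qed

text \<open>
The permuted series at the point \<open>z\<close> is a rearrangement of the original one at the point \<open>z \<circ> \<pi>\<close>, which
lies in the polydisc and has finitely many nonzero coordinates as well.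
\<close>

lemma bohr_bounded_dirichlet_action:
  assumes \<sigma>: "\<sigma> permutes {1..}" and a: "bohr_bounded a M"
  shows "bohr_bounded (dirichlet_action \<sigma> a) M"
  unfolding bohr_bounded_def
proof (intro allI impI)
  fix z :: "nat \<Rightarrow> complex"
  assume z: "finite {p. prime p \<and> z p \<noteq> 0}" "\<forall>p. prime p \<longrightarrow> norm (z p) < 1"
  obtain \<pi> where \<pi>: "bij_betw \<pi> {p. prime p} {p. prime p}"
    and act: "\<And>a n. n > 0 \<Longrightarrow> dirichlet_action \<sigma> a (mult_ext \<pi> n) = a n"
    using dirichlet_action_relabels[OF \<sigma>] by blast
  have \<pi>p: "prime (\<pi> p)" if "prime p" for p
    using \<pi> that by (auto simp: bij_betw_def)
  have bij: "bij_betw (mult_ext \<pi>) {1..} {1..}" by (rule bij_betw_mult_ext[OF \<pi>])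
  let ?f = "\<lambda>n. dirichlet_action \<sigma> a n * mult_ext z n"
  have f: "?f (mult_ext \<pi> n) = a n * mult_ext (\<lambda>p. z (\<pi> p)) n" if "n \<in> {1..}" for n
    using that by (simp add: act mult_ext_mult_ext \<pi>p)
  have "finite {p. prime p \<and> z (\<pi> p) \<noteq> 0}"
  proof (rule inj_on_finite)
    show "inj_on \<pi> {p. prime p \<and> z (\<pi> p) \<noteq> 0}"
      using \<pi> by (auto simp: bij_betw_def inj_on_def)
    show "\<pi> ` {p. prime p \<and> z (\<pi> p) \<noteq> 0} \<subseteq> {p. prime p \<and> z p \<noteq> 0}"
      using \<pi>p by auto
  qed (rule z)
  note bdd = bohr_boundedD[OF a this]
  have "?f summable_on {1..} \<longleftrightarrow> (\<lambda>n. ?f (mult_ext \<pi> n)) summable_on {1..}"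
    by (rule summable_on_reindex_bij_betw[OF bij, symmetric])
  also have "\<dots> \<longleftrightarrow> (\<lambda>n. a n * mult_ext (\<lambda>p. z (\<pi> p)) n) summable_on {1..}"
    by (rule summable_on_cong[OF f])
  finally have "?f summable_on {1..}" using bdd(1) z \<pi>p by simp
  moreover have "infsum ?f {1..} = (\<Sum>\<^sub>\<infinity>n\<in>{1..}. ?f (mult_ext \<pi> n))"
    by (rule infsum_reindex_bij_betw[OF bij, symmetric])
  then have "infsum ?f {1..} = (\<Sum>\<^sub>\<infinity>n\<in>{1..}. a n * mult_ext (\<lambda>p. z (\<pi> p)) n)"
    by (simp only: infsum_cong[OF f])
  ultimately show "?f summable_on {1..} \<and> norm (infsum ?f {1..}) \<le> M"
    using bdd(2) z \<pi>p by simp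
qed

lemma dirichlet_dilate_action:
  assumes \<sigma>: "\<sigma> permutes {1..}"
  shows "dirichlet_dilate r (dirichlet_action \<sigma> a) = dirichlet_action \<sigma> (dirichlet_dilate r a)"
proof
  fix n
  obtain \<pi> where \<pi>: "bij_betw \<pi> {p. prime p} {p. prime p}"
    and act: "\<And>a n. n > 0 \<Longrightarrow> dirichlet_action \<sigma> a (mult_ext \<pi> n) = a n"
    using dirichlet_action_relabels[OF \<sigma>] by blast
  have \<pi>p: "prime (\<pi> p)" if "prime p" for p
    using \<pi> that by (auto simp: bij_betw_def)
  show "dirichlet_dilate r (dirichlet_action \<sigma> a) n = dirichlet_action \<sigma> (dirichlet_dilate r a) n"
  proof (cases "n = 0")
    case False
    then have "n \<in> mult_ext \<pi> ` {1..}"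
      using bij_betw_mult_ext[OF \<pi>] by (simp add: bij_betw_def)
    then obtain m where "m \<in> {1..}" "n = mult_ext \<pi> m" by blast
    then show ?thesis
      by (simp add: act dirichlet_dilate_def prime_factorization_mult_ext \<pi>p)
  qed (simp add: dirichlet_dilate_def dirichlet_action_def)
qed

lemma summable_iff_summable_on_positive:
  fixes c :: "nat \<Rightarrow> complex"
  assumes "c 0 = 0"
  shows "summable (\<lambda>n. norm (c n)) \<longleftrightarrow> (\<lambda>n. norm (c n)) summable_on {1..}"
proof -
  have "summable (\<lambda>n. norm (c n)) \<longleftrightarrow> (\<lambda>n. norm (c n)) summable_on UNIV"
    by (rule summable_on_UNIV_nonneg_real_iff[symmetric]) simp
  also have "\<dots> \<longleftrightarrow> (\<lambda>n. norm (c n)) summable_on {1..}"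
    using assms by (intro summable_on_cong_neutral) (auto simp: not_le)
  finally show ?thesis .
qed

lemma summable_dirichlet_action:
  assumes \<sigma>: "\<sigma> permutes {1..}" and c: "c 0 = 0" "summable (\<lambda>n. norm (c n))"
  shows "summable (\<lambda>n. norm (dirichlet_action \<sigma> c n))"
proof -
  obtain \<pi> where \<pi>: "bij_betw \<pi> {p. prime p} {p. prime p}"
    and act: "\<And>a n. n > 0 \<Longrightarrow> dirichlet_action \<sigma> a (mult_ext \<pi> n) = a n"
    using dirichlet_action_relabels[OF \<sigma>] by blast
  have "(\<lambda>n. norm (dirichlet_action \<sigma> c n)) summable_on {1..}
      \<longleftrightarrow> (\<lambda>n. norm (dirichlet_action \<sigma> c (mult_ext \<pi> n))) summable_on {1..}"
    by (rule summable_on_reindex_bij_betw[OF bij_betw_mult_ext[OF \<pi>], symmetric])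
  also have "\<dots> \<longleftrightarrow> (\<lambda>n. norm (c n)) summable_on {1..}"
    by (intro summable_on_cong) (simp add: act)
  finally show ?thesis
    using c by (simp add: summable_iff_summable_on_positive dirichlet_action_def)
qed

theorem proposition2p4:
  fixes \<A> :: "(complex \<Rightarrow> complex) set" and \<sigma> :: "nat \<Rightarrow> nat"
  assumes "\<A> \<in> {O_b, dirichlet_W, dirichlet_A, H_infinity}"
    and "\<sigma> permutes {1..}"
  shows "dirichlet_action \<sigma> ` dirichlet_series_of \<A> \<subseteq> dirichlet_series_of \<A>"
proof safe
  fix a assume a: "a \<in> dirichlet_series_of \<A>"
  note \<sigma> = \<open>\<sigma> permutes {1..}\<close>
  have act0: "dirichlet_action \<sigma> b 0 = 0" for b by (simp add: dirichlet_action_def)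
  from assms(1) consider "\<A> = O_b" | "\<A> = dirichlet_W" | "\<A> = dirichlet_A" | "\<A> = H_infinity"
    by auto
  then show "dirichlet_action \<sigma> a \<in> dirichlet_series_of \<A>"
  proof cases
    case 1
    with a have "\<exists>M. bohr_bounded (dirichlet_dilate r a) M" if "r \<in> {0<..<1}" for r
      using that by (simp add: dirichlet_series_of_O_b)
    then have "\<exists>M. bohr_bounded (dirichlet_dilate r (dirichlet_action \<sigma> a)) M" if "r \<in> {0<..<1}" for r
      using that bohr_bounded_dirichlet_action[OF \<sigma>] unfolding dirichlet_dilate_action[OF \<sigma>] by blast
    then show ?thesis using 1 act0 by (simp add: dirichlet_series_of_O_b)
  next
    case 2
    with a show ?thesis
      using summable_dirichlet_action[OF \<sigma>] act0 by (simp add: dirichlet_series_of_W)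
  next
    case 3
    have "\<exists>c. c 0 = 0 \<and> summable (\<lambda>n. norm (c n)) \<and> bohr_bounded (\<lambda>n. dirichlet_action \<sigma> a n - c n) \<epsilon>"
      if "\<epsilon> > 0" for \<epsilon>
    proof -
      obtain c where c: "c 0 = 0" "summable (\<lambda>n. norm (c n))" "bohr_bounded (\<lambda>n. a n - c n) \<epsilon>"
        using a 3 \<open>\<epsilon> > 0\<close> by (auto simp: dirichlet_series_of_A)
      have "bohr_bounded (\<lambda>n. dirichlet_action \<sigma> a n - dirichlet_action \<sigma> c n) \<epsilon>"
        by (rule bohr_bounded_cong[OF bohr_bounded_dirichlet_action[OF \<sigma> c(3)]])
          (simp add: dirichlet_action_def)
      then show ?thesis
        using summable_dirichlet_action[OF \<sigma> c(1,2)] act0 by (intro exI[of _ "dirichlet_action \<sigma> c"]) simp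
    qed
    then show ?thesis using 3 act0 by (simp add: dirichlet_series_of_A)
  next
    case 4
    with a obtain M where "bohr_bounded a M" by (auto simp: dirichlet_series_of_H_infinity)
    then show ?thesis
      using 4 act0 bohr_bounded_dirichlet_action[OF \<sigma>] by (auto simp: dirichlet_series_of_H_infinity)
  qed
qed

end
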